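(* Let $M$ be a loopless matroid of rank $d+1$ on $E=\{0,\dots,n\}$. For each $0\le c\le d$, the cap product map $A^c_\nabla(M)\to\operatorname{MW}_{d-c}(\Sigma_M)$, $\xi\mapsto\xi\cap\Delta_M$, induces a bijection between the nested basis of $A^c_\nabla(M)$, namely the monomials \[h_{F_1}^{a_1}\cdots h_{F_k}^{a_k},\quad \textstyle\sum_i a_i=c,\ \emptyset=F_0\subsetneq F_1\subsetneq\cdots\subsetneq F_k\text{ flats of }M,\ 1\le a_i<\operatorname{rk}_M(F_i)-\operatorname{rk}_M(F_{i-1}),\] and the set of Bergman classes $\Delta_{M'}$ of loopless relative nested quotients $M'\twoheadleftarrow M$ with $\operatorname{rk}(M')=\operatorname{rk}(M)-c$.
   Context: Let $N=\mathbb Z^E/\mathbb Z\mathbf e_E$ and $u_S$ the image of $\sum_{i\in S}\mathbf e_i$. The Bergman fan $\Sigma_M$ is the fan whose cones are $\operatorname{Cone}(u_{F_1},\dots,u_{F_k})$ for chains $\emptyset\subsetneq F_1\subsetneq\cdots\subsetneq F_k\subsetneq E$ of flats of $M$ (a subfan of the braid fan, whose cones come from chains of arbitrary subsets). For a smooth fan $\Sigma$, $A^\bullet(\Sigma)=\mathbb R[x_\rho]/(\text{monomials of non-faces}+\langle\sum_\rho m(u_\rho)x_\rho:m\in N^\vee\rangle)$; $\operatorname{MW}_\ell(\Sigma)$ is the space of Minkowski weights (functions on $\ell$-cones satisfying the balancing condition $\sum_{\sigma\succ\tau}\Delta(\sigma)u_{\sigma\setminus\tau}\in\operatorname{span}\tau$);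 the cap product is $(\xi\cap\Delta)(\sigma)=$ value of the functional $\prod_{\rho\in\tau}x_\rho\mapsto\Delta(\tau)$ on $\xi\prod_{\rho\in\sigma}x_\rho$. The Chow ring $A^\bullet(M)=A^\bullet(\Sigma_M)$ has variables $x_F$ for nonempty proper flats; the simplicial presentation $A^\bullet_\nabla(M)$ has generators $h_F$ ($F$ nonempty flat) with $h_F=\alpha-\sum_{F\subseteq G\subsetneq E}x_G$, where $\alpha=\sum_{G\ni i}x_G$ for any $i\in E$ (sums over proper flats). For a loopless matroid $M'$ of rank $r'$ on $E$, the Bergman class $\Delta_{M'}$ is the $(r'-1)$-dimensional weight equal to $1$ on cones of chains of $r'-1$ proper nonempty flats of $M'$ and $0$ elsewhere. $M'$ is a quotient of $M$ ($f:M'\twoheadleftarrow M$) if every flat of $M'$ is a flat of $M$; $n_f(A)=\operatorname{rk}_M(A)-\operatorname{rk}_{M'}(A)$; an $f$-cyclic flat is a flat $F$ of $M'$ minimal under inclusion among flats of $M'$ with the same $f$-nullity; $M'$ is a relative nested quotient of $M$ if its $f$-cyclic flats form a chain. *)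

theory Defs
  imports Complex_Main "HOL-Library.Poly_Mapping"
begin

definition matroid :: "'a set \<Rightarrow> ('a set \<Rightarrow> bool) \<Rightarrow> bool" where
  "matroid E I \<longleftrightarrow> finite E \<and> I {} \<and> (\<forall>A. I A \<longrightarrow> A \<subseteq> E)
     \<and> (\<forall>A B. I B \<and> A \<subseteq> B \<longrightarrow> I A)
     \<and> (\<forall>A B. I A \<and> I B \<and> card A < card B \<longrightarrow> (\<exists>x\<in>B - A. I (insert x A)))"

definition rk :: "('a set \<Rightarrow> bool) \<Rightarrow> 'a set \<Rightarrow> nat" where
  "rk I A = Max (card ` {B. B \<subseteq> A \<and> I B})"

definition loopless :: "'a set \<Rightarrow> ('a set \<Rightarrow> bool) \<Rightarrow> bool" where
  "loopless E I \<longleftrightarrow> (\<forall>x\<in>E. I {x})"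

definition flat :: "'a set \<Rightarrow> ('a set \<Rightarrow> bool) \<Rightarrow> 'a set \<Rightarrow> bool" where
  "flat E I F \<longleftrightarrow> F \<subseteq> E \<and> (\<forall>x\<in>E - F. rk I F < rk I (insert x F))"

definition is_quotient :: "'a set \<Rightarrow> ('a set \<Rightarrow> bool) \<Rightarrow> ('a set \<Rightarrow> bool) \<Rightarrow> bool" where
  "is_quotient E I' I \<longleftrightarrow> (\<forall>F. flat E I' F \<longrightarrow> flat E I F)"

definition nullity :: "('a set \<Rightarrow> bool) \<Rightarrow> ('a set \<Rightarrow> bool) \<Rightarrow> 'a set \<Rightarrow> int" where
  "nullity I' I A = int (rk I A) - int (rk I' A)"

definition f_cyclic_flat :: "'a set \<Rightarrow> ('a set \<Rightarrow> bool) \<Rightarrow> ('a set \<Rightarrow> bool) \<Rightarrow> 'a set \<Rightarrow> bool" where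
  "f_cyclic_flat E I' I F \<longleftrightarrow> flat E I' F \<and>
     (\<forall>G. flat E I' G \<and> G \<subset> F \<longrightarrow> nullity I' I G \<noteq> nullity I' I F)"

definition relative_nested :: "'a set \<Rightarrow> ('a set \<Rightarrow> bool) \<Rightarrow> ('a set \<Rightarrow> bool) \<Rightarrow> bool" where
  "relative_nested E I' I \<longleftrightarrow>
     (\<forall>F G. f_cyclic_flat E I' I F \<and> f_cyclic_flat E I' I G \<longrightarrow> F \<subseteq> G \<or> G \<subseteq> F)"

definition rays :: "'a set \<Rightarrow> ('a set \<Rightarrow> bool) \<Rightarrow> 'a set set" where
  "rays E I = {F. flat E I F \<and> F \<noteq> {} \<and> F \<noteq> E}"

text \<open>k-dimensional cones of the Bergman fan, identified with their set of rays.\<close>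
definition kcone :: "'a set \<Rightarrow> ('a set \<Rightarrow> bool) \<Rightarrow> nat \<Rightarrow> 'a set set \<Rightarrow> bool" where
  "kcone E I k \<sigma> \<longleftrightarrow> \<sigma> \<subseteq> rays E I \<and> (\<forall>F\<in>\<sigma>. \<forall>G\<in>\<sigma>. F \<subseteq> G \<or> G \<subseteq> F)
       \<and> finite \<sigma> \<and> card \<sigma> = k"

definition bergman :: "'a set \<Rightarrow> ('a set \<Rightarrow> bool) \<Rightarrow> 'a set set \<Rightarrow> real" where
  "bergman E I \<sigma> = (if kcone E I (rk I E - 1) \<sigma> then 1 else 0)"

type_synonym 'a chowpoly = "('a set \<Rightarrow>\<^sub>0 nat) \<Rightarrow>\<^sub>0 real"

definition Xv :: "'a set \<Rightarrow> 'a chowpoly" where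
  "Xv F = Poly_Mapping.single (Poly_Mapping.single F 1) 1"

definition expo :: "'a set set \<Rightarrow> ('a set \<Rightarrow>\<^sub>0 nat)" where
  "expo \<sigma> = (\<Sum>F\<in>\<sigma>. Poly_Mapping.single F 1)"

definition xmono :: "'a set set \<Rightarrow> 'a chowpoly" where
  "xmono \<sigma> = Poly_Mapping.single (expo \<sigma>) 1"

definition mdeg :: "('a set \<Rightarrow>\<^sub>0 nat) \<Rightarrow> nat" where
  "mdeg m = (\<Sum>F\<in>Poly_Mapping.keys m. Poly_Mapping.lookup m F)"

definition ideal_gen :: "'a chowpoly set \<Rightarrow> 'a chowpoly set" where
  "ideal_gen G = {p. \<exists>S q. finite S \<and> S \<subseteq> G \<and> p = (\<Sum>g\<in>S. q g * g)}"

text \<open>Linear form sum_rho m(u_rho) x_rho for m in the dual lattice (integer vectors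
  on E with coordinate sum 0, i.e. vanishing on e_E); here m(u_F) = sum_{i in F} m i.\<close>
definition linrel :: "'a set \<Rightarrow> ('a set \<Rightarrow> bool) \<Rightarrow> ('a \<Rightarrow> int) \<Rightarrow> 'a chowpoly" where
  "linrel E I m = (\<Sum>F\<in>rays E I. of_int (\<Sum>i\<in>F. m i) * Xv F)"

definition chow_ideal :: "'a set \<Rightarrow> ('a set \<Rightarrow> bool) \<Rightarrow> 'a chowpoly set" where
  "chow_ideal E I = ideal_gen
     ({xmono \<sigma> | \<sigma>. finite \<sigma> \<and> \<sigma> \<subseteq> rays E I \<and> \<not> (\<forall>F\<in>\<sigma>. \<forall>G\<in>\<sigma>. F \<subseteq> G \<or> G \<subseteq> F)}
      \<union> {linrel E I m | m. (\<Sum>i\<in>E. m i) = 0})"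

definition lin_eval :: "(('a set \<Rightarrow>\<^sub>0 nat) \<Rightarrow> real) \<Rightarrow> 'a chowpoly \<Rightarrow> real" where
  "lin_eval w p = (\<Sum>m\<in>Poly_Mapping.keys p. Poly_Mapping.lookup p m * w m)"

text \<open>The degree functional A^l(Sigma_M) -> R attached to an l-dimensional weight Delta:
  the linear functional (given by its values w on monomials) vanishing on the Chow ideal,
  on monomials of degree different from l and on monomials in non-ray variables,
  and sending x_tau to Delta(tau) for every l-cone tau.\<close>
definition deg_fun :: "'a set \<Rightarrow> ('a set \<Rightarrow> bool) \<Rightarrow> nat \<Rightarrow> ('a set set \<Rightarrow> real)
     \<Rightarrow> (('a set \<Rightarrow>\<^sub>0 nat) \<Rightarrow> real)" where
  "deg_fun E I l \<Delta> = (THE w.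
      (\<forall>m. mdeg m \<noteq> l \<or> \<not> Poly_Mapping.keys m \<subseteq> rays E I \<longrightarrow> w m = 0)
    \<and> (\<forall>\<tau>. kcone E I l \<tau> \<longrightarrow> w (expo \<tau>) = \<Delta> \<tau>)
    \<and> (\<forall>p\<in>chow_ideal E I. lin_eval w p = 0))"

definition cap :: "'a set \<Rightarrow> ('a set \<Rightarrow> bool) \<Rightarrow> nat \<Rightarrow> nat \<Rightarrow> 'a chowpoly
     \<Rightarrow> ('a set set \<Rightarrow> real) \<Rightarrow> ('a set set \<Rightarrow> real)" where
  "cap E I l k \<xi> \<Delta> = (\<lambda>\<sigma>. if kcone E I k \<sigma> then lin_eval (deg_fun E I l \<Delta>) (\<xi> * xmono \<sigma>) else 0)"

text \<open>alpha = sum of x_G over proper flats G containing a fixed element i of E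
  (the class is independent of i; we fix i = 0, which lies in E = {0..n}).\<close>
definition alpha :: "nat set \<Rightarrow> (nat set \<Rightarrow> bool) \<Rightarrow> nat chowpoly" where
  "alpha E I = (\<Sum>G\<in>{G\<in>rays E I. (0::nat) \<in> G}. Xv G)"

definition hgen :: "nat set \<Rightarrow> (nat set \<Rightarrow> bool) \<Rightarrow> nat set \<Rightarrow> nat chowpoly" where
  "hgen E I F = alpha E I - (\<Sum>G\<in>{G\<in>rays E I. F \<subseteq> G}. Xv G)"

definition nested_basis :: "nat set \<Rightarrow> (nat set \<Rightarrow> bool) \<Rightarrow> nat \<Rightarrow> nat chowpoly set" where
  "nested_basis E I c = {(\<Prod>i<length Fs. hgen E I (Fs ! i) ^ (as ! i)) | Fs as.
      length as = length Fs
    \<and> (\<forall>i<length Fs. flat E I (Fs ! i))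
    \<and> (\<forall>i<length Fs. (if i = 0 then {} else Fs ! (i - 1)) \<subset> Fs ! i)
    \<and> (\<forall>i<length Fs. 1 \<le> as ! i \<and>
          as ! i + rk I (if i = 0 then {} else Fs ! (i - 1)) < rk I (Fs ! i))
    \<and> sum_list as = c}"

end

theory Submission
  imports Defs
begin

text \<open>
  Put \<open>h\<^sub>E = \<alpha>\<close> and \<open>x\<^sub>E = - \<alpha>\<close>. Modulo the linear relations of the Chow ring,
  \<open>- h\<^sub>F\<close> is the sum of the \<open>x\<^sub>G\<close> over all flats \<open>G \<supseteq> F\<close>, and \<open>h\<^sub>a = 0\<close> for atoms, so a degree
  functional may be prescribed freely on monomials in the \<open>h\<^sub>F\<close>: give such a monomial the value 1
  if the principal truncations of \<open>M\<close> along its factors leave a loopless matroid of rank one, and 0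
  otherwise. By construction \<open>h\<^sub>F\<close> acts as the truncation along \<open>F\<close>. The remaining relations are
  \<open>(h\<^sub>F - h\<^sub>J) (h\<^sub>G - h\<^sub>J) = 0\<close> with \<open>J = F \<or> G\<close>; truncating along the other factors reduces them
  to rank three, where they are checked by hand. Hence capping with a monomial in the \<open>h\<^sub>F\<close> yields
  the Bergman class of an iterated truncation. For a nested monomial the cyclic flats of this
  truncation are \<open>\<emptyset>, F\<^sub>1, \<dots>, F\<^sub>k\<close> with nullities the partial sums of the exponents, and any
  quotient is determined by its cyclic flats together with their nullities.
\<close>

subsection \<open>Rank functions and principal truncations\<close>

text \<open>\<open>deg_fun\<close> is a definite description, so a functional with its three
  properties must be exhibited and shown unique before anything can be computed. These properties
  give explicit values only on squarefree chain monomials in the x_F; the other values are implicit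
  in the relations. On monomials in the h_F all values are explicit, which is why the functional is
  built on that side. Adding E to the index set makes the passage between h_F and x_F triangular
  along inclusion of flats, so it can be inverted. The quadratic relation expands into products x_K
  x_L of incomparable flats in which x_F x_G is the only term not closer to E; an induction towards
  E then isolates the single products. The vanishing of atoms and of incomparable products is proved
  for every quotient r' of the fixed rank function r, because truncation leaves M but stays among
  its quotients, while the flats of M go on indexing the variables. Truncations are handled as bare
  rank functions, where they have a closed formula; independence predicates return only where the
  theorem asks for matroids.\<close>

lemma finite_chain_greatest:
  assumes "finite S" "S \<noteq> {}" and chain: "\<forall>K\<in>S. \<forall>L\<in>S. K \<subseteq> L \<or> L \<subseteq> K"
  shows "\<exists>M\<in>S. \<forall>K\<in>S. K \<subseteq> M"
proof -
  obtain M where M: "M \<in> S" "\<forall>K\<in>S. M \<subseteq> K \<longrightarrow> M = K"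
    using finite_has_maximal[OF assms(1,2)] by (elim bexE)
  have "K \<subseteq> M" if "K \<in> S" for K
  proof -
    have "M \<subseteq> K \<or> K \<subseteq> M" using chain M(1) that by simp
    then show ?thesis using M(2)[rule_format, OF that] by (elim disjE) auto
  qed
  with M(1) show ?thesis by blast
qed

lemma finite_chain_least:
  assumes "finite S" "S \<noteq> {}" and chain: "\<forall>K\<in>S. \<forall>L\<in>S. K \<subseteq> L \<or> L \<subseteq> K"
  shows "\<exists>M\<in>S. \<forall>K\<in>S. M \<subseteq> K"
proof -
  obtain M where M: "M \<in> S" "\<forall>K\<in>S. K \<subseteq> M \<longrightarrow> M = K"
    using finite_has_minimal[OF assms(1,2)] by (elim bexE)
  have "M \<subseteq> K" if "K \<in> S" for K
  proof -
    have "M \<subseteq> K \<or> K \<subseteq> M" using chain M(1) that by simp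
    then show ?thesis using M(2)[rule_format, OF that] by (elim disjE) auto
  qed
  with M(1) show ?thesis by blast
qed

text \<open>Principal truncation: the rank of \<open>A\<close> drops by one when \<open>A\<close>
  spans \<open>F\<close>, see \<open>trunc_eq\<close>. The condition \<open>1 \<le> r F\<close>
  makes the natural subtraction exact and the result a rank function.\<close>

definition trunc :: "'a set \<Rightarrow> ('a set \<Rightarrow> nat) \<Rightarrow> 'a set \<Rightarrow> nat" where
  "trunc F r A = min (r A) (r (A \<union> F) - 1)"

definition rflat :: "'a set \<Rightarrow> ('a set \<Rightarrow> nat) \<Rightarrow> 'a set \<Rightarrow> bool" where
  "rflat E r F \<longleftrightarrow> F \<subseteq> E \<and> (\<forall>x\<in>E - F. r F < r (insert x F))"

lemma flat_eq_rflat: "flat E I = rflat E (rk I)"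
  by (simp add: fun_eq_iff flat_def rflat_def)

definition closure :: "'a set \<Rightarrow> ('a set \<Rightarrow> nat) \<Rightarrow> 'a set \<Rightarrow> 'a set" where
  "closure E r A = {x \<in> E. r (insert x A) = r A}"

text \<open>Ranks are defined on all sets of the type. By \<open>Int_ground\<close> points outside
  \<open>E\<close> behave as loops, so that \<open>rk_indep_of_rank\<close> can be an equality of
  functions.\<close>

locale rank_function =
  fixes E :: "'a set" and r :: "'a set \<Rightarrow> nat"
  assumes fin: "finite E"
    and empty [simp]: "r {} = 0"
    and mono: "A \<subseteq> B \<Longrightarrow> r A \<le> r B"
    and insert_le: "r (insert x A) \<le> Suc (r A)"
    and submod: "r (A \<union> B) + r (A \<inter> B) \<le> r A + r B"
    and Int_ground: "r (A \<inter> E) = r A"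
begin

text \<open>Diminishing returns: submodularity for \<open>B\<close> and \<open>A \<union> C\<close>,
  whose intersection contains \<open>A\<close>.\<close>

lemma union_eq_mono:
  assumes "A \<subseteq> B" "r (A \<union> C) = r A"
  shows "r (B \<union> C) = r B"
proof -
  have "r (B \<union> (A \<union> C)) + r (B \<inter> (A \<union> C)) \<le> r B + r A"
    using submod[of B "A \<union> C"] assms(2) by simp
  moreover have "r A \<le> r (B \<inter> (A \<union> C))" "r B \<le> r (B \<union> C)"
    using assms(1) by (auto intro: mono)
  moreover have "B \<union> (A \<union> C) = B \<union> C" using assms(1) by auto
  ultimately show ?thesis by simp
qed

lemma insert_eq_mono:
  assumes "A \<subseteq> B" "r (insert x A) = r A"
  shows "r (insert x B) = r B"
  using union_eq_mono[OF assms(1), of "{x}"] assms(2) by simp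

lemma union_eq:
  assumes "\<And>x. x \<in> B \<inter> E \<Longrightarrow> r (insert x A) = r A"
  shows "r (A \<union> B) = r A"
proof -
  have *: "r (A \<union> C) = r A" if "finite C" "C \<subseteq> B \<inter> E" for C
    using that
  proof (induction C)
    case (insert x C)
    then show ?case
      using insert_eq_mono[of A "A \<union> C" x] assms[of x] by simp
  qed simp
  have "r (A \<union> B) = r ((A \<union> B) \<inter> E)" by (simp add: Int_ground)
  also have "\<dots> = r ((A \<union> (B \<inter> E)) \<inter> E)" by (rule arg_cong[of _ _ r]) auto
  also have "\<dots> = r (A \<union> (B \<inter> E))" by (simp add: Int_ground)
  also have "\<dots> = r A" using fin by (intro *) auto
  finally show ?thesis .
qed

lemma closure_subset: "closure E r A \<subseteq> E"
  by (auto simp: closure_def)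

lemma subset_closure: "A \<subseteq> E \<Longrightarrow> A \<subseteq> closure E r A"
  by (auto simp: closure_def insert_absorb)

lemma union_closure: "r (A \<union> closure E r A) = r A"
  by (rule union_eq) (auto simp: closure_def)

lemma rank_closure: "r (closure E r A) = r A"
proof (rule antisym)
  show "r (closure E r A) \<le> r A"
    using mono[of "closure E r A" "A \<union> closure E r A"] union_closure by simp
  have "A \<inter> E \<subseteq> closure E r A" by (auto simp: closure_def insert_absorb)
  then show "r A \<le> r (closure E r A)" using mono Int_ground by metis
qed

lemma rflat_closure: "rflat E r (closure E r A)"
  unfolding rflat_def
proof (intro conjI ballI closure_subset)
  fix x assume x: "x \<in> E - closure E r A"
  then have "r A < r (insert x A)"
    using mono[of A "insert x A"] by (force simp: closure_def)
  also have "r (insert x A) \<le> r (insert x (A \<inter> E))"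
  proof -
    have "insert x A \<inter> E = insert x (A \<inter> E) \<inter> E" by auto
    then show ?thesis by (metis Int_ground order_refl)
  qed
  also have "\<dots> \<le> r (insert x (closure E r A))"
    by (rule mono) (auto simp: closure_def insert_absorb)
  finally show "r (closure E r A) < r (insert x (closure E r A))"
    by (simp add: rank_closure)
qed

lemma rflat_insertD:
  assumes "rflat E r F" "x \<in> E" "r (insert x F) = r F"
  shows "x \<in> F"
  using assms by (force simp: rflat_def)

lemma closure_least:
  assumes "rflat E r F" "A \<subseteq> F"
  shows "closure E r A \<subseteq> F"
proof
  fix x assume "x \<in> closure E r A"
  then show "x \<in> F"
    using rflat_insertD[OF assms(1)] insert_eq_mono[OF assms(2)] by (auto simp: closure_def)
qed

lemma rflat_unionD:
  assumes "rflat E r F" "B \<subseteq> E" "r (F \<union> B) \<le> r F"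
  shows "B \<subseteq> F"
proof
  fix x assume "x \<in> B"
  then have "r (insert x F) \<le> r F"
    using mono[of "insert x F" "F \<union> B"] assms(3) by auto
  then show "x \<in> F"
    using rflat_insertD[OF assms(1)] mono[of F "insert x F"] \<open>x \<in> B\<close> assms(2) by force
qed

lemma rflat_psubset_less:
  assumes "rflat E r F" "G \<subseteq> E" "F \<subset> G"
  shows "r F < r G"
proof (rule ccontr)
  assume "\<not> r F < r G"
  then have "G \<subseteq> F" using rflat_unionD[OF assms(1,2)] assms(3) by (simp add: sup.absorb2)
  with assms(3) show False by auto
qed

lemma rflat_ground: "rflat E r E"
  by (simp add: rflat_def)

lemma rank_le_ground: "r A \<le> r E"
  using Int_ground[of A] mono[of "A \<inter> E" E] by auto

lemma union_le: "r (A \<union> B) \<le> r A + r B"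
  using submod[of A B] by simp

lemma singleton_le: "r {x} \<le> 1"
  using insert_le[of x "{}"] by simp

lemma finite_rflats: "finite {F. rflat E r F}"
  by (rule finite_subset[of _ "Pow E"]) (auto simp: rflat_def fin)

lemma trunc_eq:
  "trunc F r A = (if r (A \<union> F) = r A then r A - 1 else r A)"
  using mono[of A "A \<union> F"] by (auto simp: trunc_def min_def)

lemma rank_function_trunc:
  assumes "1 \<le> r F"
  shows "rank_function E (trunc F r)"
proof
  have F: "1 \<le> r (A \<union> F)" for A using mono[of F "A \<union> F"] assms by simp
  show "finite E" by (rule fin)
  show "trunc F r {} = 0" by (simp add: trunc_def)
  show "trunc F r A \<le> trunc F r B" if "A \<subseteq> B" for A B
  proof -
    have "r A \<le> r B" "r (A \<union> F) \<le> r (B \<union> F)" using that by (auto intro: mono)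
    then show ?thesis by (auto simp: trunc_def min_def)
  qed
  show "trunc F r (insert x A) \<le> Suc (trunc F r A)" for x A
    using insert_le[of x A] insert_le[of x "A \<union> F"] by (auto simp: trunc_def min_def)
  show "trunc F r (A \<inter> E) = trunc F r A" for A
  proof -
    have "(A \<inter> E \<union> F) \<inter> E = (A \<union> F) \<inter> E" by auto
    then show ?thesis unfolding trunc_def by (metis Int_ground)
  qed
  show "trunc F r (A \<union> B) + trunc F r (A \<inter> B) \<le> trunc F r A + trunc F r B" for A B
  proof -
    \<comment> \<open>For \<open>A\<close> and \<open>B\<close> the truncated rank equals one of the
      two terms of the minimum; for union and intersection it is bounded by both. The resulting
      cases need plain submodularity, \<open>mixed\<close> in either order, and
      \<open>both\<close>.\<close>
    have mixed: "r (A \<union> B \<union> F) + r (A \<inter> B) \<le> r A + r (B \<union> F)" for A B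
    proof -
      have "r (A \<union> (B \<union> F)) + r (A \<inter> (B \<union> F)) \<le> r A + r (B \<union> F)" by (rule submod)
      moreover have "r (A \<inter> B) \<le> r (A \<inter> (B \<union> F))" by (rule mono) auto
      ultimately show ?thesis by (simp add: Un_assoc)
    qed
    have both: "r (A \<union> B \<union> F) + r (A \<inter> B \<union> F) \<le> r (A \<union> F) + r (B \<union> F)"
    proof -
      have "(A \<union> F) \<union> (B \<union> F) = A \<union> B \<union> F" "(A \<union> F) \<inter> (B \<union> F) = A \<inter> B \<union> F" by auto
      then show ?thesis using submod[of "A \<union> F" "B \<union> F"] by simp
    qed
    have le: "trunc F r C \<le> r C" "Suc (trunc F r C) \<le> r (C \<union> F)" for C
      using F[of C] by (auto simp: trunc_def)
    have eq: "trunc F r C = r C \<or> Suc (trunc F r C) = r (C \<union> F)" for C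
      using F[of C] by (auto simp: trunc_def min_def)
    have mixed': "r (A \<union> B \<union> F) + r (A \<inter> B) \<le> r B + r (A \<union> F)"
      using mixed[of B A] by (simp add: Un_commute Int_commute)
    show ?thesis
      using submod[of A B] mixed[of A B] mixed' both le[of "A \<union> B"] le[of "A \<inter> B"] eq[of A] eq[of B]
      by linarith
  qed
qed

end

text \<open>Subtraction-free form of "the nullity r - r' is monotone". By
  \<open>rank_quotient_rflat\<close> and \<open>rank_quotient_of_rflats\<close> it expresses that
  flats of \<open>r'\<close> are flats of \<open>r\<close>, and it bounds ranks of arbitrary
  sets.\<close>

definition rank_quotient :: "('a set \<Rightarrow> nat) \<Rightarrow> ('a set \<Rightarrow> nat) \<Rightarrow> bool" where
  "rank_quotient r r' \<longleftrightarrow> (\<forall>A B. A \<subseteq> B \<longrightarrow> r' B + r A \<le> r B + r' A)"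

lemma rank_quotientD: "rank_quotient r r' \<Longrightarrow> A \<subseteq> B \<Longrightarrow> r' B + r A \<le> r B + r' A"
  by (simp add: rank_quotient_def)

lemma rank_quotient_refl: "rank_quotient r r"
  by (simp add: rank_quotient_def)

lemma rank_quotient_trans:
  assumes "rank_quotient r s" "rank_quotient s t"
  shows "rank_quotient r t"
  unfolding rank_quotient_def
proof (intro allI impI)
  fix A B :: "'a set" assume "A \<subseteq> B"
  then have "s B + r A \<le> r B + s A" "t B + s A \<le> s B + t A"
    using assms by (auto simp: rank_quotient_def)
  then show "t B + r A \<le> r B + t A" by linarith
qed

lemma rank_quotient_rflat:
  assumes "rank_quotient r r'" "rflat E r' F"
  shows "rflat E r F"
  unfolding rflat_def
proof (intro conjI ballI)
  fix x assume "x \<in> E - F"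
  then have "r' F < r' (insert x F)" using assms(2) by (simp add: rflat_def)
  moreover have "r' (insert x F) + r F \<le> r (insert x F) + r' F"
    by (rule rank_quotientD[OF assms(1)]) auto
  ultimately show "r F < r (insert x F)" by simp
qed (use assms(2) in \<open>simp add: rflat_def\<close>)

text \<open>The nullity of a truncation is 1 on sets spanning \<open>F\<close> and 0 elsewhere, and
  supersets of spanning sets span.\<close>

lemma (in rank_function) rank_quotient_trunc:
  assumes "1 \<le> r F"
  shows "rank_quotient r (trunc F r)"
  unfolding rank_quotient_def
proof (intro allI impI)
  fix A B :: "'a set" assume "A \<subseteq> B"
  have "1 \<le> r (A \<union> F)" using mono[of F "A \<union> F"] assms by simp
  then show "trunc F r B + r A \<le> r B + trunc F r A"
    using union_eq_mono[OF \<open>A \<subseteq> B\<close>, of F] mono[OF \<open>A \<subseteq> B\<close>] by (auto simp: trunc_eq)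
qed

text \<open>What adds no rank in \<open>r\<close> adds none in a quotient. So a quotient treats an
  atom like one of its points and a join of flats like their union.\<close>

lemma rank_quotient_union_closure:
  assumes "rank_function E r" "rank_function E r'" "rank_quotient r r'"
  shows "r' (A \<union> closure E r B) = r' (A \<union> B)"
proof -
  interpret r: rank_function E r by fact
  interpret r': rank_function E r' by fact
  have "r' (B \<union> closure E r B) + r B \<le> r (B \<union> closure E r B) + r' B"
    by (rule rank_quotientD[OF assms(3)]) auto
  then have "r' (B \<union> closure E r B) \<le> r' B" by (simp add: r.union_closure)
  then have *: "r' (B \<union> closure E r B) = r' B" using r'.mono[of B "B \<union> closure E r B"] by auto
  have "r' (A \<union> B \<union> closure E r B) = r' (A \<union> B)"
    by (rule r'.union_eq_mono[OF _ *]) auto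
  moreover have "(A \<union> B \<union> closure E r B) \<inter> E = (A \<union> closure E r B) \<inter> E"
    by (auto simp: closure_def insert_absorb)
  ultimately show ?thesis by (metis r'.Int_ground)
qed

subsection \<open>Matroids and their rank functions\<close>

lemma matroidD:
  assumes "matroid E I"
  shows "finite E" "I {}" "I A \<Longrightarrow> A \<subseteq> E" "I B \<Longrightarrow> A \<subseteq> B \<Longrightarrow> I A"
    "I A \<Longrightarrow> I B \<Longrightarrow> card A < card B \<Longrightarrow> \<exists>x\<in>B - A. I (insert x A)"
  using assms unfolding matroid_def by blast+

lemma matroid_extend:
  assumes M: "matroid E I" and "I X" "X \<subseteq> A"
  obtains Y where "I Y" "X \<subseteq> Y" "Y \<subseteq> A" "card Y = rk I A"
proof -
  note finE = matroidD(1)[OF M] and sub = matroidD(3)[OF M]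
  have fin: "finite {B. B \<subseteq> A \<and> I B}" by (rule finite_subset[of _ "Pow E"]) (use finE sub in auto)
  have le: "card B \<le> rk I A" if "I B" "B \<subseteq> A" for B
    unfolding rk_def using that fin by (intro Max_ge) auto
  obtain Z where Z: "I Z" "Z \<subseteq> A" "card Z = rk I A"
  proof -
    have "rk I A \<in> card ` {B. B \<subseteq> A \<and> I B}"
      unfolding rk_def using fin assms by (intro Max_in) auto
    then show ?thesis using that by auto
  qed
  have "\<exists>Y. I Y \<and> X \<subseteq> Y \<and> Y \<subseteq> A \<and> card Y = rk I A" if "I X" "X \<subseteq> A" for X
    using that
  proof (induction "rk I A - card X" arbitrary: X rule: less_induct)
    case less
    show ?case
    proof (cases "card X = rk I A")
      case False
      with le less.prems have lt: "card X < card Z" using Z by (simp add: order_less_le)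
      then obtain x where x: "x \<in> Z - X" "I (insert x X)"
        using matroidD(5)[OF M less.prems(1) Z(1)] by blast
      have "finite X" using sub[OF less.prems(1)] finE finite_subset by blast
      then have "card (insert x X) = Suc (card X)" using x by simp
      then have "rk I A - card (insert x X) < rk I A - card X" using lt Z by simp
      from less.hyps[OF this x(2)] x Z less.prems show ?thesis by auto
    qed (use less.prems in auto)
  qed
  then show ?thesis using assms that by blast
qed

lemma card_le_rk:
  assumes "matroid E I" "I B" "B \<subseteq> A"
  shows "card B \<le> rk I A"
proof -
  have "finite {B. B \<subseteq> A \<and> I B}"
    by (rule finite_subset[of _ "Pow E"]) (use matroidD(1,3)[OF assms(1)] in auto)
  then show ?thesis unfolding rk_def using assms by (intro Max_ge) auto
qed

lemma rank_function_rk: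
  assumes M: "matroid E I"
  shows "rank_function E (rk I)"
proof
  note finE = matroidD(1)[OF M] and emp = matroidD(2)[OF M]
    and sub = matroidD(3)[OF M] and her = matroidD(4)[OF M]
  have finI: "finite B" if "I B" for B using sub[OF that] finE finite_subset by blast
  note ext = matroid_extend[OF M]
  show "finite E" by (rule finE)
  show "rk I {} = 0" using ext[OF emp, of "{}"] by auto
  show "rk I A \<le> rk I B" if "A \<subseteq> B" for A B
    using ext[OF emp, of A] card_le_rk[OF M] that by (metis empty_subsetI order_trans)
  show "rk I (insert x A) \<le> Suc (rk I A)" for x A
  proof -
    obtain Y where Y: "I Y" "Y \<subseteq> insert x A" "card Y = rk I (insert x A)"
      using ext[OF emp, of "insert x A"] by auto
    have "card (Y - {x}) \<le> rk I A" using Y her by (intro card_le_rk[OF M]) auto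
    then show ?thesis using Y finI[OF Y(1)] by (simp add: card_Diff_singleton_if split: if_splits)
  qed
  show "rk I (A \<inter> E) = rk I A" for A
  proof -
    have "{B. B \<subseteq> A \<inter> E \<and> I B} = {B. B \<subseteq> A \<and> I B}" using sub by blast
    then show ?thesis by (simp add: rk_def)
  qed
  show "rk I (A \<union> B) + rk I (A \<inter> B) \<le> rk I A + rk I B" for A B
  proof -
    \<comment> \<open>A basis of the intersection, extended to a basis of the union, splits into
      independent parts of \<open>A\<close> and \<open>B\<close> that overlap at least in
      \<open>X\<close>.\<close>
    obtain X where X: "I X" "X \<subseteq> A \<inter> B" "card X = rk I (A \<inter> B)"
      using ext[OF emp, of "A \<inter> B"] by auto
    then obtain Y where Y: "I Y" "X \<subseteq> Y" "Y \<subseteq> A \<union> B" "card Y = rk I (A \<union> B)"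
      using ext[OF X(1), of "A \<union> B"] by auto
    have "card Y = card (Y \<inter> A \<union> Y \<inter> B)" using Y by (intro arg_cong[of _ _ card]) auto
    moreover have "card (Y \<inter> A) + card (Y \<inter> B) = card (Y \<inter> A \<union> Y \<inter> B) + card ((Y \<inter> A) \<inter> (Y \<inter> B))"
      using finI[OF Y(1)] by (intro card_Un_Int) auto
    moreover have "card X \<le> card ((Y \<inter> A) \<inter> (Y \<inter> B))"
      using finI[OF Y(1)] X Y by (intro card_mono) auto
    moreover have "card (Y \<inter> A) \<le> rk I A" "card (Y \<inter> B) \<le> rk I B"
      using Y her by (auto intro!: card_le_rk[OF M])
    ultimately show ?thesis using X Y by linarith
  qed
qed

text \<open>The way back from truncated rank functions to independence predicates; inverse to
  \<open>rk\<close> by \<open>rk_indep_of_rank\<close> and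
  \<open>indep_eq_indep_of_rank\<close>.\<close>

definition indep_of_rank :: "'a set \<Rightarrow> ('a set \<Rightarrow> nat) \<Rightarrow> 'a set \<Rightarrow> bool" where
  "indep_of_rank E r A \<longleftrightarrow> A \<subseteq> E \<and> r A = card A"

context rank_function
begin

lemma le_card_diff: "finite B \<Longrightarrow> A \<subseteq> B \<Longrightarrow> r B \<le> r A + card (B - A)"
proof (induction "card (B - A)" arbitrary: A)
  case 0
  then have "A = B" by auto
  then show ?case by simp
next
  case (Suc k)
  then obtain x where x: "x \<in> B - A" by (metis card.empty equals0I nat.distinct(1))
  have "B - A = insert x (B - insert x A)" using x by auto
  then have c: "card (B - A) = Suc (card (B - insert x A))" using Suc.prems by (metis Diff_iff card_insert_disjoint finite_Diff insertI1)
  have "r B \<le> r (insert x A) + card (B - insert x A)"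
    using Suc.hyps(1)[of "insert x A"] Suc.hyps(2) Suc.prems x c by auto
  then show ?case using insert_le[of x A] c by simp
qed

lemma le_card: "finite A \<Longrightarrow> r A \<le> card A"
  using le_card_diff[of A "{}"] by simp

lemma matroid_indep_of_rank: "matroid E (indep_of_rank E r)"
proof -
  have her: "r A = card A" if "r B = card B" "A \<subseteq> B" "B \<subseteq> E" for A B
  proof -
    have "finite B" using that fin finite_subset by blast
    then have "finite A" using that(2) finite_subset by blast
    have "card (B - A) + card A = card B"
      using \<open>finite B\<close> \<open>finite A\<close> that(2) by (simp add: card_Diff_subset card_mono)
    then show ?thesis
      using le_card_diff[OF \<open>finite B\<close> that(2)] le_card[OF \<open>finite A\<close>] that(1) by linarith
  qed
  have aug: "\<exists>x\<in>B - A. r (insert x A) = card (insert x A)"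
    if AB: "A \<subseteq> E" "B \<subseteq> E" "r A = card A" "r B = card B" "card A < card B" for A B
  proof (rule ccontr)
    assume neg: "\<not> ?thesis"
    have finA: "finite A" using AB fin finite_subset by blast
    have "r (insert x A) = r A" if "x \<in> B \<inter> E" for x
    proof (cases "x \<in> A")
      case False
      then have "r (insert x A) \<noteq> Suc (r A)" using neg that finA AB by auto
      then show ?thesis using insert_le[of x A] mono[OF subset_insertI, of A x] by linarith
    qed (simp add: insert_absorb)
    then have "r (A \<union> B) = r A" by (rule union_eq)
    then show False using mono[of B "A \<union> B"] AB by simp
  qed
  show ?thesis
    unfolding matroid_def indep_of_rank_def
  proof (intro conjI allI impI)
    fix A B assume "(B \<subseteq> E \<and> r B = card B) \<and> A \<subseteq> B"
    then show "A \<subseteq> E" "r A = card A" using her[of B A] by auto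
  next
    fix A B assume "(A \<subseteq> E \<and> r A = card A) \<and> (B \<subseteq> E \<and> r B = card B) \<and> card A < card B"
    then show "\<exists>x\<in>B - A. insert x A \<subseteq> E \<and> r (insert x A) = card (insert x A)"
      using aug[of A B] by blast
  qed (use fin in auto)
qed

text \<open>No point of \<open>A\<close> raises the rank of a maximal independent \<open>Y\<close>
  in \<open>A\<close>, so \<open>union_eq\<close> gives \<open>r A = card Y\<close>.\<close>

lemma rk_indep_of_rank: "rk (indep_of_rank E r) = r"
proof
  fix A
  let ?I = "indep_of_rank E r"
  obtain Y where Y: "?I Y" "Y \<subseteq> A" "card Y = rk ?I A"
    using matroid_extend[OF matroid_indep_of_rank, of "{}" A] by (auto simp: indep_of_rank_def)
  then have "rk ?I A \<le> r A" using mono[of Y A] by (simp add: indep_of_rank_def)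
  have "r (insert x Y) = r Y" if "x \<in> A \<inter> E" for x
  proof (rule ccontr)
    assume neq: "r (insert x Y) \<noteq> r Y"
    then have "r (insert x Y) = Suc (r Y)" "x \<notin> Y"
      using insert_le[of x Y] mono[OF subset_insertI, of Y x] by (auto simp: insert_absorb)
    moreover have "finite Y" using Y fin finite_subset by (auto simp: indep_of_rank_def)
    ultimately have "?I (insert x Y)" "card (insert x Y) = Suc (card Y)"
      using Y that by (auto simp: indep_of_rank_def)
    moreover have "card (insert x Y) \<le> rk ?I A"
      using Y that calculation(1) by (intro card_le_rk[OF matroid_indep_of_rank]) auto
    ultimately show False using Y by simp
  qed
  then have "r (Y \<union> A) = r Y" by (rule union_eq)
  with Y have "r A = card Y" by (simp add: indep_of_rank_def sup.absorb2)
  with Y show "rk ?I A = r A" by simp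
qed

end

lemma indep_eq_indep_of_rank:
  assumes M: "matroid E I"
  shows "I = indep_of_rank E (rk I)"
proof
  fix A
  have "rk I A = card A" if "I A"
  proof (rule antisym)
    interpret rank_function E "rk I" by (rule rank_function_rk[OF M])
    have "finite A" using matroidD(1,3)[OF M] that finite_subset by blast
    then show "rk I A \<le> card A" by (rule le_card)
    show "card A \<le> rk I A" using that by (intro card_le_rk[OF M]) auto
  qed
  moreover have "I A" if A: "A \<subseteq> E" "rk I A = card A"
  proof -
    obtain Y where Y: "I Y" "Y \<subseteq> A" "card Y = rk I A"
      using matroid_extend[OF M, of "{}" A] matroidD(2)[OF M] by auto
    have "finite A" using matroidD(1)[OF M] A finite_subset by blast
    then have "Y = A" using Y A by (simp add: card_subset_eq)
    with Y show ?thesis by simp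
  qed
  ultimately show "I A \<longleftrightarrow> indep_of_rank E (rk I) A"
    using matroidD(3)[OF M] by (auto simp: indep_of_rank_def)
qed

lemma loopless_iff_rk:
  assumes M: "matroid E I"
  shows "loopless E I \<longleftrightarrow> (\<forall>x\<in>E. rk I {x} = 1)"
proof -
  have "I {x} \<longleftrightarrow> indep_of_rank E (rk I) {x}" for x
    using indep_eq_indep_of_rank[OF M] by metis
  then have "I {x} \<longleftrightarrow> rk I {x} = 1" if "x \<in> E" for x
    using that by (simp add: indep_of_rank_def)
  then show ?thesis by (auto simp: loopless_def)
qed

subsection \<open>Polynomials and substitution\<close>

abbreviation "lookup \<equiv> Poly_Mapping.lookup"
abbreviation "keys \<equiv> Poly_Mapping.keys"
abbreviation "single \<equiv> Poly_Mapping.single"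

lemma sum_single_keys:
  fixes p :: "'k \<Rightarrow>\<^sub>0 'b::comm_monoid_add"
  shows "(\<Sum>m\<in>keys p. single m (lookup p m)) = p"
proof (rule poly_mapping_eqI)
  fix k
  show "lookup (\<Sum>m\<in>keys p. single m (lookup p m)) k = lookup p k"
    by (simp add: lookup_sum lookup_single when_def sum.delta in_keys_iff)
qed

lemma poly_induct [case_names single add]:
  fixes p :: "'k \<Rightarrow>\<^sub>0 'b::comm_monoid_add"
  assumes "\<And>m c. P (single m c)" "\<And>p q. P p \<Longrightarrow> P q \<Longrightarrow> P (p + q)"
  shows "P p"
proof -
  have "P (\<Sum>m\<in>A. single m (lookup p m))" if "finite A" for A
    using that
  proof induction
    case empty
    show ?case using assms(1)[of undefined 0] by simp
  qed (simp add: assms)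
  from this[of "keys p"] show ?thesis by (simp add: sum_single_keys)
qed

lemma sum_keys_superset:
  assumes "finite A" "keys p \<subseteq> A" "\<And>m. f m 0 = 0"
  shows "(\<Sum>m\<in>keys p. f m (lookup p m)) = (\<Sum>m\<in>A. f m (lookup p m))"
  by (rule sum.mono_neutral_left) (use assms in \<open>auto simp: in_keys_iff\<close>)

lemma lin_eval_superset:
  assumes "finite A" "keys p \<subseteq> A"
  shows "lin_eval w p = (\<Sum>m\<in>A. lookup p m * w m)"
  unfolding lin_eval_def by (rule sum_keys_superset[OF assms]) simp

lemma lin_eval_add: "lin_eval w (p + q) = lin_eval w p + lin_eval w q"
proof -
  let ?A = "keys p \<union> keys q"
  have "lin_eval w s = (\<Sum>m\<in>?A. lookup s m * w m)" if "s \<in> {p, q, p + q}" for s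
    using that keys_add[of p q] by (intro lin_eval_superset) auto
  then show ?thesis by (simp add: lookup_add distrib_right sum.distrib)
qed

lemma lin_eval_zero [simp]: "lin_eval w 0 = 0"
  by (simp add: lin_eval_def)

lemma lin_eval_sum: "lin_eval w (\<Sum>i\<in>A. f i) = (\<Sum>i\<in>A. lin_eval w (f i))"
  by (induction A rule: infinite_finite_induct) (simp_all add: lin_eval_add)

lemma lin_eval_uminus: "lin_eval w (- p) = - lin_eval w p"
  using lin_eval_add[of w p "- p"] by simp

lemma lin_eval_diff: "lin_eval w (p - q) = lin_eval w p - lin_eval w q"
  using lin_eval_add[of w p "- q"] by (simp add: lin_eval_uminus)

lemma lin_eval_single [simp]: "lin_eval w (single m c) = c * w m"
  by (simp add: lin_eval_def)

lemma lin_eval_const_mult: "lin_eval w (single 0 c * p) = c * lin_eval w p"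
  by (induction p rule: poly_induct)
     (simp_all add: mult_single lin_eval_add distrib_left mult.assoc)

lemma lin_eval_single_mult: "lin_eval w (single m 1 * p) = lin_eval (\<lambda>k. w (m + k)) p"
  by (induction p rule: poly_induct) (simp_all add: mult_single lin_eval_add distrib_left)

section \<open>Substitution of polynomials for variables\<close>

definition subst_mono :: "('v \<Rightarrow> 'b::comm_ring_1) \<Rightarrow> ('v \<Rightarrow>\<^sub>0 nat) \<Rightarrow> 'b" where
  "subst_mono X m = (\<Prod>v\<in>keys m. X v ^ lookup m v)"

text \<open>Source and target have the same type, but the variable of \<open>F\<close> is read as
  x_F before the substitution and as h_F after it.\<close>

definition subst :: "('a set \<Rightarrow> 'a chowpoly) \<Rightarrow> 'a chowpoly \<Rightarrow> 'a chowpoly" where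
  "subst X p = (\<Sum>m\<in>keys p. single 0 (lookup p m) * subst_mono X m)"

lemma subst_mono_superset:
  assumes "finite A" "keys m \<subseteq> A"
  shows "subst_mono X m = (\<Prod>v\<in>A. X v ^ lookup m v)"
  unfolding subst_mono_def
  by (rule prod.mono_neutral_left) (use assms in \<open>auto simp: in_keys_iff\<close>)

lemma subst_mono_zero [simp]: "subst_mono X 0 = 1"
  by (simp add: subst_mono_def)

lemma subst_mono_single [simp]: "subst_mono X (single v k) = X v ^ k"
  by (simp add: subst_mono_def)

lemma subst_mono_add: "subst_mono X (m + k) = subst_mono X m * subst_mono X k"
proof -
  let ?A = "keys m \<union> keys k"
  have "subst_mono X s = (\<Prod>v\<in>?A. X v ^ lookup s v)" if "s \<in> {m, k, m + k}" for s
    using that keys_add[of m k] by (intro subst_mono_superset) auto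
  then show ?thesis by (simp add: lookup_add power_add prod.distrib)
qed

lemma subst_mono_sum: "subst_mono X (\<Sum>i\<in>A. f i) = (\<Prod>i\<in>A. subst_mono X (f i))"
  by (induction A rule: infinite_finite_induct) (simp_all add: subst_mono_add)

lemma subst_single [simp]: "subst X (single m c) = single 0 c * subst_mono X m"
  by (simp add: subst_def)

lemma subst_zero [simp]: "subst X 0 = 0"
  by (simp add: subst_def)

lemma subst_add: "subst X (p + q) = subst X p + subst X q"
proof -
  let ?A = "keys p \<union> keys q"
  have "subst X s = (\<Sum>m\<in>?A. single 0 (lookup s m) * subst_mono X m)" if "s \<in> {p, q, p + q}" for s
    unfolding subst_def using that keys_add[of p q] by (intro sum_keys_superset) auto
  then show ?thesis by (simp add: lookup_add single_add distrib_right sum.distrib)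
qed

lemma subst_mult: "subst X (p * q) = subst X p * subst X q"
proof (induction p rule: poly_induct)
  case (single m c)
  show ?case
  proof (induction q rule: poly_induct)
    case (single k e)
    have "subst X (single m c * single k e) = single 0 (c * e) * (subst_mono X m * subst_mono X k)"
      by (simp add: mult_single subst_mono_add)
    also have "single 0 (c * e) = single 0 c * single (0 :: 'a set \<Rightarrow>\<^sub>0 nat) e" by (simp add: mult_single)
    finally show ?case by (simp add: ac_simps)
  qed (simp add: distrib_left subst_add)
qed (simp add: distrib_right subst_add)

lemma subst_one [simp]: "subst X 1 = 1"
  by (simp add: subst_def)

lemma subst_Xv [simp]: "subst X (Xv F) = X F"
  by (simp add: Xv_def)

lemma subst_of_int [simp]: "subst X (of_int z) = of_int z"
proof -
  have "(of_int z :: 'a chowpoly) = single 0 (of_int z)" by simp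
  then show ?thesis using subst_single[of X 0 "of_int z"] by simp
qed

lemma subst_sum: "subst X (\<Sum>i\<in>A. f i) = (\<Sum>i\<in>A. subst X (f i))"
  by (induction A rule: infinite_finite_induct) (simp_all add: subst_add)

lemma subst_power: "subst X (p ^ k) = subst X p ^ k"
  by (induction k) (simp_all add: subst_mult)

lemma subst_uminus: "subst X (- p) = - subst X p"
  using subst_add[of X p "- p"] by (simp add: eq_neg_iff_add_eq_0 add.commute)

lemma subst_diff: "subst X (p - q) = subst X p - subst X q"
  using subst_add[of X p "- q"] by (simp add: subst_uminus)

lemma subst_xmono [simp]: "subst X (xmono \<sigma>) = (\<Prod>F\<in>\<sigma>. X F)"
  by (simp add: xmono_def expo_def subst_mono_sum)

text \<open>Pulls a functional back along the ring map \<open>subst X\<close> and writes it as a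
  weight on monomials, the form that \<open>deg_fun\<close> demands.\<close>

lemma lin_eval_subst: "lin_eval (\<lambda>m. lin_eval w (subst_mono X m)) p = lin_eval w (subst X p)"
  by (induction p rule: poly_induct)
     (simp_all add: lin_eval_const_mult lin_eval_add subst_add)

section \<open>Degrees and homogeneous polynomials\<close>

lemma mdeg_superset: "finite A \<Longrightarrow> keys m \<subseteq> A \<Longrightarrow> mdeg m = (\<Sum>v\<in>A. lookup m v)"
  unfolding mdeg_def by (rule sum_keys_superset) auto

lemma mdeg_add: "mdeg (m + k) = mdeg m + mdeg k"
proof -
  let ?A = "keys m \<union> keys k"
  have "mdeg s = (\<Sum>v\<in>?A. lookup s v)" if "s \<in> {m, k, m + k}" for s
    using that keys_add[of m k] by (intro mdeg_superset) auto
  then show ?thesis by (simp add: lookup_add sum.distrib)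
qed

lemma mdeg_zero [simp]: "mdeg 0 = 0"
  by (simp add: mdeg_def)

lemma mdeg_single [simp]: "mdeg (single v k) = k"
  by (simp add: mdeg_def)

lemma keys_add_nat: "keys (m + k) = keys m \<union> keys (k :: 'v \<Rightarrow>\<^sub>0 nat)"
  by (auto simp: in_keys_iff lookup_add)

definition homogeneous :: "nat \<Rightarrow> 'a chowpoly \<Rightarrow> bool" where
  "homogeneous k p \<longleftrightarrow> (\<forall>m\<in>keys p. mdeg m = k)"

lemma homogeneous_add: "homogeneous k p \<Longrightarrow> homogeneous k q \<Longrightarrow> homogeneous k (p + q)"
  using keys_add[of p q] by (auto simp: homogeneous_def)

lemma homogeneous_zero [simp]: "homogeneous k 0"
  by (simp add: homogeneous_def)

lemma homogeneous_sum: "(\<And>i. i \<in> A \<Longrightarrow> homogeneous k (f i)) \<Longrightarrow> homogeneous k (\<Sum>i\<in>A. f i)"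
  by (induction A rule: infinite_finite_induct) (auto simp: homogeneous_add)

lemma homogeneous_uminus: "homogeneous k p \<Longrightarrow> homogeneous k (- p)"
  by (simp add: homogeneous_def in_keys_iff)

lemma homogeneous_diff: "homogeneous k p \<Longrightarrow> homogeneous k q \<Longrightarrow> homogeneous k (p - q)"
  using homogeneous_add[of k p "- q"] by (simp add: homogeneous_uminus)

lemma homogeneous_mult: "homogeneous k p \<Longrightarrow> homogeneous l q \<Longrightarrow> homogeneous (k + l) (p * q)"
  using keys_mult[of p q] by (fastforce simp: homogeneous_def mdeg_add)

lemma homogeneous_one [simp]: "homogeneous 0 1"
  by (simp add: homogeneous_def)

lemma homogeneous_power: "homogeneous k p \<Longrightarrow> homogeneous (j * k) (p ^ j)"
  by (induction j) (auto simp: homogeneous_mult)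

lemma homogeneous_prod:
  "(\<And>i. i \<in> A \<Longrightarrow> homogeneous (d i) (f i)) \<Longrightarrow> homogeneous (\<Sum>i\<in>A. d i) (\<Prod>i\<in>A. f i)"
  by (induction A rule: infinite_finite_induct) (auto simp: homogeneous_mult)

lemma homogeneous_Xv [simp]: "homogeneous 1 (Xv F)"
  by (simp add: homogeneous_def Xv_def)

lemma homogeneous_subst_mono:
  assumes "\<And>F. homogeneous 1 (X F)"
  shows "homogeneous (mdeg m) (subst_mono X m)"
  unfolding subst_mono_def mdeg_def
  using homogeneous_power[OF assms] by (intro homogeneous_prod) fastforce

subsection \<open>The degree functional in terms of the simplicial generators\<close>

text \<open>The dragon Hall--Rado condition: the truncations along the factors of \<open>m\<close> are a loopless
  rank function of rank one.\<close>
definition dragon :: "'a set \<Rightarrow> ('a set \<Rightarrow> nat) \<Rightarrow> ('a set \<Rightarrow>\<^sub>0 nat) \<Rightarrow> real" where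
  "dragon E r m = (if Suc (mdeg m) = r E \<and>
     (\<forall>x\<in>E. \<forall>k l. m = k + l \<longrightarrow> Suc (mdeg k) \<le> r ({x} \<union> \<Union>(keys k))) then 1 else 0)"

text \<open>Variables are read as h_F. The rank function is a parameter because each truncation
  changes it while the variables stay the same.\<close>

definition vol :: "'a set \<Rightarrow> ('a set \<Rightarrow> nat) \<Rightarrow> 'a chowpoly \<Rightarrow> real" where
  "vol E r p = lin_eval (dragon E r) p"

text \<open>A factor \<open>F\<close> of a product cancels from one of the two cofactors. This sorts
  the divisors of the enlarged monomial by whether they use the new factor.\<close>

lemma single_add_eq_cases:
  assumes "single F 1 + m = k + (l :: 'v \<Rightarrow>\<^sub>0 nat)"
  obtains k' where "k = single F 1 + k'" "m = k' + l"
  | l' where "l = single F 1 + l'" "m = k + l'"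
proof -
  have split: "p = single F 1 + (p - single F 1)" if "lookup p F > 0" for p :: "'v \<Rightarrow>\<^sub>0 nat"
    by (rule poly_mapping_eqI) (use that in \<open>auto simp: lookup_add lookup_minus lookup_single when_def\<close>)
  have "lookup (single F 1 + m) F = lookup (k + l) F" using assms by simp
  then have "lookup k F > 0 \<or> lookup l F > 0" by (auto simp: lookup_add)
  then show ?thesis
  proof
    assume "lookup k F > 0"
    then have k: "k = single F 1 + (k - single F 1)" by (rule split)
    have "single F 1 + m = single F 1 + ((k - single F 1) + l)"
      using assms k by (metis add.assoc)
    then show ?thesis using that(1)[OF k] by simp
  next
    assume "lookup l F > 0"
    then have l: "l = single F 1 + (l - single F 1)" by (rule split)
    have "single F 1 + m = single F 1 + (k + (l - single F 1))"
      using assms l by (metis add.left_commute)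
    then show ?thesis using that(2)[OF l] by simp
  qed
qed

lemma (in rank_function) trunc_ground: "trunc F r E = r E - 1"
  using rank_le_ground[of "E \<union> F"] mono[of E "E \<union> F"] by (auto simp: trunc_def min_def)

text \<open>Each divisor \<open>k\<close> of \<open>m\<close> yields the divisors \<open>k\<close>
  and F times \<open>k\<close> of the larger monomial. Their conditions bound the two terms of the
  minimum in \<open>trunc\<close>, so together they are the condition on \<open>k\<close> for the
  truncation.\<close>

lemma (in rank_function) dragon_single_add:
  "dragon E r (single F 1 + m) = dragon E (trunc F r) m"
proof -
  have "(\<forall>k l. single F 1 + m = k + l \<longrightarrow> Suc (mdeg k) \<le> r ({x} \<union> \<Union>(keys k))) \<longleftrightarrow>
    (\<forall>k l. m = k + l \<longrightarrow> Suc (mdeg k) \<le> trunc F r ({x} \<union> \<Union>(keys k)))" (is "?A \<longleftrightarrow> ?B") for x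
  proof
    assume A: ?A
    show ?B
    proof (intro allI impI)
      fix k l assume m: "m = k + l"
      have "single F 1 + m = k + (single F 1 + l)" using m by (simp add: add.left_commute)
      with A have 1: "Suc (mdeg k) \<le> r ({x} \<union> \<Union>(keys k))" by blast
      have "single F 1 + m = (single F 1 + k) + l" using m by (simp add: add.assoc)
      with A have "Suc (mdeg (single F 1 + k)) \<le> r ({x} \<union> \<Union>(keys (single F 1 + k)))" by blast
      moreover have "{x} \<union> \<Union>(keys (single F 1 + k)) = {x} \<union> \<Union>(keys k) \<union> F"
        by (auto simp: keys_add_nat)
      ultimately show "Suc (mdeg k) \<le> trunc F r ({x} \<union> \<Union>(keys k))"
        using 1 by (simp add: trunc_def mdeg_add)
    qed
  next
    assume B: ?B
    show ?A
    proof (intro allI impI)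
      fix k l assume "single F 1 + m = k + l"
      then show "Suc (mdeg k) \<le> r ({x} \<union> \<Union>(keys k))"
      proof (cases rule: single_add_eq_cases)
        case (1 k')
        then have "Suc (mdeg k') \<le> trunc F r ({x} \<union> \<Union>(keys k'))" using B by blast
        moreover have "{x} \<union> \<Union>(keys (single F 1 + k')) = {x} \<union> \<Union>(keys k') \<union> F"
          by (auto simp: keys_add_nat)
        ultimately show ?thesis using 1 by (simp add: trunc_def mdeg_add) linarith
      next
        case (2 l')
        then have "Suc (mdeg k) \<le> trunc F r ({x} \<union> \<Union>(keys k))" using B by blast
        then show ?thesis by (simp add: trunc_def)
      qed
    qed
  qed
  moreover have "Suc (mdeg (single F 1 + m)) = r E \<longleftrightarrow> Suc (mdeg m) = trunc F r E"
    by (auto simp: mdeg_add trunc_ground)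
  ultimately show ?thesis unfolding dragon_def by simp
qed

lemma vol_add: "vol E r (p + q) = vol E r p + vol E r q"
  by (simp add: vol_def lin_eval_add)

lemma vol_diff: "vol E r (p - q) = vol E r p - vol E r q"
  by (simp add: vol_def lin_eval_diff)

lemma vol_uminus: "vol E r (- p) = - vol E r p"
  by (simp add: vol_def lin_eval_uminus)

lemma vol_sum: "vol E r (\<Sum>i\<in>A. f i) = (\<Sum>i\<in>A. vol E r (f i))"
  by (simp add: vol_def lin_eval_sum)

lemma vol_zero [simp]: "vol E r 0 = 0"
  by (simp add: vol_def)

lemma vol_Xv_mult:
  assumes "rank_function E r"
  shows "vol E r (Xv F * p) = vol E (trunc F r) p"
  unfolding vol_def Xv_def lin_eval_single_mult
  using rank_function.dragon_single_add[OF assms] by simp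

text \<open>At a loop the trivial divisor 0 already violates the dragon condition.\<close>

lemma vol_loop:
  assumes "x \<in> E" "r {x} = 0"
  shows "vol E r p = 0"
proof -
  have "dragon E r m = 0" for m
  proof -
    have "m = 0 + m" "\<not> Suc (mdeg (0 :: 'a set \<Rightarrow>\<^sub>0 nat)) \<le> r ({x} \<union> \<Union>(keys (0 :: 'a set \<Rightarrow>\<^sub>0 nat)))"
      using assms by simp_all
    then show ?thesis using assms(1) unfolding dragon_def by meson
  qed
  then show ?thesis by (simp add: vol_def lin_eval_def)
qed

lemma vol_homogeneous:
  assumes "homogeneous k p" "Suc k \<noteq> r E"
  shows "vol E r p = 0"
proof -
  have "dragon E r m = 0" if "m \<in> keys p" for m
    using that assms by (auto simp: homogeneous_def dragon_def)
  then show ?thesis by (simp add: vol_def lin_eval_def)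
qed

lemma vol_one: "vol E r 1 = (if r E = 1 \<and> (\<forall>x\<in>E. 1 \<le> r {x}) then 1 else 0)"
proof -
  have "0 = k + l \<longleftrightarrow> k = 0 \<and> l = 0" for k l :: "'a set \<Rightarrow>\<^sub>0 nat"
    using keys_add_nat[of k l] by (metis Un_empty add_0 keys_eq_empty keys_zero)
  then have "dragon E r 0 = (if r E = 1 \<and> (\<forall>x\<in>E. 1 \<le> r {x}) then 1 else 0)"
    by (auto simp: dragon_def)
  then show ?thesis by (simp add: vol_def lin_eval_def)
qed

text \<open>Truncation along a set of rank zero turns every point into a loop. This settles the
  factors for which \<open>trunc F r\<close> may fail to be a rank function.\<close>

lemma vol_trunc_rank_zero:
  assumes "rank_function E r" "r F = 0" "E \<noteq> {}"
  shows "vol E (trunc F r) p = 0"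
proof -
  interpret rank_function E r by fact
  obtain x where "x \<in> E" using assms(3) by auto
  moreover have "r ({x} \<union> F) \<le> 1" using union_le[of "{x}" F] singleton_le[of x] assms(2) by simp
  ultimately show ?thesis by (intro vol_loop[of x]) (auto simp: trunc_def)
qed

lemma vol_Xv_Xv:
  assumes "rank_function E r" and loopless: "\<And>x. x \<in> E \<Longrightarrow> r {x} = 1"
    and A: "A \<noteq> {}" "A \<subseteq> E" and B: "B \<noteq> {}" "B \<subseteq> E"
  shows "vol E r (Xv A * Xv B) = (if r E = 3 \<and> 2 \<le> r A \<and> 2 \<le> r B \<and> 3 \<le> r (A \<union> B) then 1 else 0)"
proof -
  interpret rank_function E r by fact
  obtain a b where a: "a \<in> A" and b: "b \<in> B" using A B by auto
  have "1 \<le> r A" using loopless[of a] mono[of "{a}" A] a A by auto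
  then interpret A: rank_function E "trunc A r" by (rule rank_function_trunc)
  have "vol E r (Xv A * Xv B) = vol E (trunc A r) (Xv B * 1)"
    by (simp add: vol_Xv_mult[OF assms(1)])
  also have "\<dots> = vol E (trunc B (trunc A r)) 1"
    by (rule vol_Xv_mult) unfold_locales
  also have "\<dots> = (if r E = 3 \<and> 2 \<le> r A \<and> 2 \<le> r B \<and> 3 \<le> r (A \<union> B) then 1 else 0)"
  proof -
    have ground: "trunc B (trunc A r) E = 1 \<longleftrightarrow> r E = 3"
      by (auto simp: A.trunc_ground trunc_ground)
    have pt: "1 \<le> trunc B (trunc A r) {x} \<longleftrightarrow>
        2 \<le> r ({x} \<union> A) \<and> 2 \<le> r ({x} \<union> B) \<and> 3 \<le> r ({x} \<union> (A \<union> B))" if "x \<in> E" for x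
      using loopless[OF that] mono[of "{x} \<union> B" "{x} \<union> (A \<union> B)"]
      by (auto simp: trunc_def Un_commute Un_left_commute)
    have "(\<forall>x\<in>E. 1 \<le> trunc B (trunc A r) {x}) \<longleftrightarrow> 2 \<le> r A \<and> 2 \<le> r B \<and> 3 \<le> r (A \<union> B)"
    proof
      assume *: "\<forall>x\<in>E. 1 \<le> trunc B (trunc A r) {x}"
      \<comment> \<open>A point of \<open>A\<close> and a point of \<open>B\<close> are absorbed by
        the sets, which turns the pointwise conditions into the ranks of \<open>A\<close>,
        \<open>B\<close> and their union.\<close>
      have "a \<in> E" "b \<in> E" "{a} \<union> A = A" "{b} \<union> B = B" "{a} \<union> (A \<union> B) = A \<union> B" using a b A B by auto
      then show "2 \<le> r A \<and> 2 \<le> r B \<and> 3 \<le> r (A \<union> B)" using * pt[of a] pt[of b] by auto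
    next
      assume *: "2 \<le> r A \<and> 2 \<le> r B \<and> 3 \<le> r (A \<union> B)"
      have "r A \<le> r ({x} \<union> A)" "r B \<le> r ({x} \<union> B)" "r (A \<union> B) \<le> r ({x} \<union> (A \<union> B))" for x
        by (auto intro: mono)
      then show "\<forall>x\<in>E. 1 \<le> trunc B (trunc A r) {x}" using * pt by (meson order_trans)
    qed
    then show ?thesis unfolding vol_one ground by simp
  qed
  finally show ?thesis .
qed

text \<open>The elements \<open>X F\<close> are the Chow generators written in terms of the \<open>h\<^sub>F\<close> (here \<open>Xv F\<close>),
  obtained by inverting \<open>- h\<^sub>F = (\<Sum>G \<supseteq> F. x\<^sub>G)\<close> with \<open>x\<^sub>E = - \<alpha>\<close>.\<close>
lemma (in rank_function) chow_generators_exist: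
  obtains X :: "'a set \<Rightarrow> 'a chowpoly"
  where "\<And>F. homogeneous 1 (X F)"
    and "\<And>F. rflat E r F \<Longrightarrow> (\<Sum>G | rflat E r G \<and> F \<subseteq> G. X G) = - Xv F"
proof -
  \<comment> \<open>Recursion from \<open>E\<close> downwards: the equation for \<open>F\<close>
    expresses \<open>X F\<close> by strictly larger flats, whose complements are smaller. The bound
    \<open>n\<close> limits the size of the complement.\<close>
  have "\<exists>X :: 'a set \<Rightarrow> 'a chowpoly. (\<forall>F. homogeneous 1 (X F)) \<and>
      (\<forall>F. rflat E r F \<and> card (E - F) < n \<longrightarrow> (\<Sum>G | rflat E r G \<and> F \<subseteq> G. X G) = - Xv F)" for n
  proof (induction n)
    case 0
    show ?case by (intro exI[of _ "\<lambda>_. 0"]) simp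
  next
    case (Suc n)
    then obtain X :: "'a set \<Rightarrow> 'a chowpoly" where X: "\<And>F. homogeneous 1 (X F)"
        "\<And>F. rflat E r F \<Longrightarrow> card (E - F) < n \<Longrightarrow> (\<Sum>G | rflat E r G \<and> F \<subseteq> G. X G) = - Xv F"
      by auto
    define X' where "X' F = (if card (E - F) = n then - Xv F - (\<Sum>G | rflat E r G \<and> F \<subset> G. X G)
        else X F)" for F
    have smaller: "card (E - G) < card (E - F)" if "rflat E r G" "F \<subset> G" for F G
      using that fin by (intro psubset_card_mono) (auto simp: rflat_def)
    have "homogeneous 1 (- Xv F - (\<Sum>G | rflat E r G \<and> F \<subset> G. X G))" for F
      by (intro homogeneous_diff homogeneous_uminus homogeneous_sum X(1) homogeneous_Xv)
    then have "homogeneous 1 (X' F)" for F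
      unfolding X'_def using X(1) by (split if_split) blast
    moreover have "(\<Sum>G | rflat E r G \<and> F \<subseteq> G. X' G) = - Xv F"
      if F: "rflat E r F" "card (E - F) < Suc n" for F
    proof -
      have eq: "{G. rflat E r G \<and> F \<subseteq> G} = insert F {G. rflat E r G \<and> F \<subset> G}" using F by auto
      have f: "finite {G. rflat E r G \<and> F \<subset> G}" by (rule finite_subset[OF _ finite_rflats]) auto
      have "(\<Sum>G | rflat E r G \<and> F \<subset> G. X' G) = (\<Sum>G | rflat E r G \<and> F \<subset> G. X G)"
      proof (rule sum.cong[OF refl])
        fix G assume "G \<in> {G. rflat E r G \<and> F \<subset> G}"
        then have "card (E - G) < n" using smaller[of G F] F(2) by simp
        then show "X' G = X G" by (simp add: X'_def)
      qed
      then have s: "(\<Sum>G | rflat E r G \<and> F \<subseteq> G. X' G) = X' F + (\<Sum>G | rflat E r G \<and> F \<subset> G. X G)"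
        unfolding eq using f by simp
      show ?thesis
      proof (cases "card (E - F) = n")
        case True
        then show ?thesis unfolding s by (simp add: X'_def)
      next
        case False
        then have "(\<Sum>G | rflat E r G \<and> F \<subseteq> G. X G) = - Xv F" using F by (intro X(2)) auto
        then have "X F + (\<Sum>G | rflat E r G \<and> F \<subset> G. X G) = - Xv F" using f by (simp add: eq)
        moreover have "X' F = X F" using False by (simp add: X'_def)
        ultimately show ?thesis unfolding s by simp
      qed
    qed
    ultimately show ?case by blast
  qed
  from this[of "Suc (card E)"] obtain X :: "'a set \<Rightarrow> 'a chowpoly" where X: "\<And>F. homogeneous 1 (X F)"
      "\<And>F. rflat E r F \<Longrightarrow> card (E - F) < Suc (card E) \<Longrightarrow> (\<Sum>G | rflat E r G \<and> F \<subseteq> G. X G) = - Xv F"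
    by auto
  have "card (E - F) < Suc (card E)" for F using fin by (simp add: card_mono less_Suc_eq_le)
  with X show ?thesis by (intro that) auto
qed

section \<open>Chains of flats and iterated truncations\<close>

lemma (in rank_function) chain_card_le:
  assumes "finite T" "\<And>K. K \<in> T \<Longrightarrow> rflat E r K \<and> G \<subset> K" "rflat E r G"
    "\<And>K L. K \<in> T \<Longrightarrow> L \<in> T \<Longrightarrow> K \<subseteq> L \<or> L \<subseteq> K"
  shows "r G + card T \<le> r E"
proof -
  have strict: "r K < r L" if "rflat E r K" "rflat E r L" "K \<subset> L" for K L
    using rflat_psubset_less[OF that(1) _ that(3)] that(2) by (simp add: rflat_def)
  have "inj_on r T"
  proof (rule inj_onI)
    fix K L assume KL: "K \<in> T" "L \<in> T" "r K = r L"
    then show "K = L" using assms(2,4) strict by (metis less_irrefl psubsetI)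
  qed
  then have "card T = card (r ` T)" by (simp add: card_image)
  also have "\<dots> \<le> card {r G<..r E}"
    using assms(2,3) strict rank_le_ground by (intro card_mono) auto
  finally show ?thesis using rank_le_ground[of G] by simp
qed

lemma (in rank_function) trunc_rflat:
  assumes "rflat E r K" "F \<subseteq> K" "1 \<le> r F"
  shows "rflat E (trunc F r) K"
  unfolding rflat_def
proof (intro conjI ballI)
  fix x assume "x \<in> E - K"
  then have "r K < r (insert x K)" using assms(1) by (simp add: rflat_def)
  moreover have "1 \<le> r K" using mono[OF assms(2)] assms(3) by simp
  moreover have "K \<union> F = K" "insert x K \<union> F = insert x K" using assms(2) by auto
  ultimately show "trunc F r K < trunc F r (insert x K)" by (simp add: trunc_def)
qed (use assms(1) in \<open>simp add: rflat_def\<close>)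

text \<open>\<open>F\<close> is a flat of the initial \<open>r\<close>, since these index the
  generators h_F. The bound \<open>2 \<le> r' F\<close> keeps the truncation loopless: no point
  drops to rank zero.\<close>

inductive iter_trunc :: "'a set \<Rightarrow> ('a set \<Rightarrow> nat) \<Rightarrow> ('a set \<Rightarrow> nat) \<Rightarrow> bool" for E r where
  base: "iter_trunc E r r"
| step: "iter_trunc E r r' \<Longrightarrow> rflat E r F \<Longrightarrow> 2 \<le> r' F \<Longrightarrow> iter_trunc E r (trunc F r')"

section \<open>Chow relations evaluated on quotients of a loopless rank function\<close>

locale chow_generators = rank_function +
  fixes X :: "'a set \<Rightarrow> 'a chowpoly"
  assumes loopless: "x \<in> E \<Longrightarrow> r {x} = 1"
    and homogeneous_X: "homogeneous 1 (X F)"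
    and sum_X: "rflat E r F \<Longrightarrow> F \<noteq> {} \<Longrightarrow> (\<Sum>G | rflat E r G \<and> F \<subseteq> G. X G) = - Xv F"
begin

lemma iter_truncD:
  assumes "iter_trunc E r r'"
  shows "rank_function E r'" "rank_quotient r r'" "\<And>x. x \<in> E \<Longrightarrow> r' {x} = 1"
  using assms
proof induction
  case base
  show "rank_function E r" by unfold_locales
  show "rank_quotient r r" by (rule rank_quotient_refl)
  show "r {x} = 1" if "x \<in> E" for x using that by (rule loopless)
next
  case (step r' F)
  then interpret r': rank_function E r' by simp
  have F: "1 \<le> r' F" using step by simp
  show "rank_function E (trunc F r')" by (rule r'.rank_function_trunc[OF F])
  show "rank_quotient r (trunc F r')"
    using rank_quotient_trans step.IH(2) r'.rank_quotient_trunc[OF F] by blast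
  show "trunc F r' {x} = 1" if "x \<in> E" for x
    using step.IH(3)[OF that] step.hyps(3) r'.mono[OF subset_insertI, of F x]
    by (simp add: trunc_def)
qed

text \<open>The relation h_a = 0 for an atom a: in a quotient the closure of \<open>x\<close> has
  the rank of \<open>x\<close>, so truncation along it makes \<open>x\<close> a loop.\<close>

lemma vol_h_closure_singleton:
  assumes "rank_function E r'" "rank_quotient r r'" "x \<in> E"
  shows "vol E r' (Xv (closure E r {x}) * p) = 0"
proof -
  interpret r': rank_function E r' by fact
  have "r' ({x} \<union> closure E r {x}) = r' ({x} \<union> {x})"
    by (rule rank_quotient_union_closure[OF _ assms(1,2)]) unfold_locales
  then have "trunc (closure E r {x}) r' {x} = 0"
    using r'.singleton_le[of x] by (simp add: trunc_def)
  then show ?thesis using vol_Xv_mult[OF assms(1)] vol_loop[OF assms(3)] by metis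
qed

lemma vol_h_quadratic:
  assumes "rank_function E r'" "rank_quotient r r'"
    and F: "F \<noteq> {}" "F \<subseteq> E" and G: "G \<noteq> {}" "G \<subseteq> E"
  shows "vol E r' ((Xv F - Xv (closure E r (F \<union> G))) * (Xv G - Xv (closure E r (F \<union> G))) * p) = 0"
proof -
  define J where "J = closure E r (F \<union> G)"
  define Q :: "'a chowpoly" where "Q = (Xv F - Xv J) * (Xv G - Xv J)"
  have J: "J \<noteq> {}" "J \<subseteq> E" "F \<subseteq> J" "G \<subseteq> J"
    using subset_closure[of "F \<union> G"] closure_subset F G by (auto simp: J_def)
  have base: "vol E r' Q = 0" if r': "rank_function E r'" "rank_quotient r r'" for r'
  proof (cases "\<forall>x\<in>E. r' {x} = 1")
    case True
    interpret r': rank_function E r' by fact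
    have eq: "r' J = r' (F \<union> G)"
      using rank_quotient_union_closure[OF rank_function_axioms r', of "{}" "F \<union> G"] by (simp add: J_def)
    \<comment> \<open>If \<open>r' E = 3\<close> and \<open>r' J = 3\<close>, the four products have
      values [r' F >= 2 and r' G >= 2], [r' F >= 2], [r' G >= 2] and 1. Their alternating sum is
      nonzero only when both ranks are at most 1, which \<open>r' J \<le> r' F + r' G\<close>
      excludes. Otherwise all four vanish.\<close>
    have "r' F \<le> r' J" "r' G \<le> r' J" "r' J \<le> r' F + r' G"
      using J r'.union_le[of F G] eq by (auto intro: r'.mono)
    moreover have "F \<union> J = J" "J \<union> G = J" using J by auto
    moreover have "Q = Xv F * Xv G - Xv F * Xv J - Xv J * Xv G + Xv J * Xv J"
      by (simp add: Q_def algebra_simps)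
    ultimately show ?thesis
      using True F G J eq
      by (simp add: vol_add vol_diff vol_Xv_Xv[OF r'(1)])
  next
    case False
    then obtain x where x: "x \<in> E" "r' {x} \<noteq> 1" by auto
    then have "r' {x} = 0" using rank_function.singleton_le[OF r'(1), of x] by simp
    with x show ?thesis by (intro vol_loop)
  qed
  \<comment> \<open>The remaining factors are absorbed one by one as truncations, which keep
    \<open>r'\<close> a quotient of \<open>r\<close>; a factor of rank zero makes the value vanish
    at once.\<close>
  have mono: "vol E r' (Q * single m 1) = 0" if "rank_function E r'" "rank_quotient r r'" for r' m
    using that
  proof (induction "mdeg m" arbitrary: m r' rule: less_induct)
    case less
    show ?case
    proof (cases "m = 0")
      case True
      then show ?thesis using base[OF less.prems] by simp
    next
      case False
      then obtain H where "H \<in> keys m" by (metis all_not_in_conv keys_eq_empty)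
      then have pos: "lookup m H > 0" by (simp add: in_keys_iff)
      define k where "k = m - single H 1"
      have m: "m = single H 1 + k"
        unfolding k_def
        by (rule poly_mapping_eqI) (use pos in \<open>auto simp: lookup_add lookup_minus lookup_single when_def\<close>)
      have "single m (1::real) = Xv H * single k 1" by (simp add: m Xv_def mult_single)
      then have "vol E r' (Q * single m 1) = vol E r' (Xv H * (Q * single k 1))"
        by (simp add: ac_simps)
      also have "\<dots> = vol E (trunc H r') (Q * single k 1)" by (rule vol_Xv_mult[OF less.prems(1)])
      also have "\<dots> = 0"
      proof (cases "r' H = 0")
        case True
        then show ?thesis using less.prems F by (intro vol_trunc_rank_zero) auto
      next
        case False
        then have "1 \<le> r' H" by simp
        note t = rank_function.rank_function_trunc[OF less.prems(1) this]
          rank_function.rank_quotient_trunc[OF less.prems(1) this]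
        have "mdeg k < mdeg m" by (simp add: m mdeg_add)
        then show ?thesis using less.hyps t rank_quotient_trans[OF less.prems(2) t(2)] by blast
      qed
      finally show ?thesis .
    qed
  qed
  have "vol E r' (Q * p) = 0"
  proof (induction p rule: poly_induct)
    case (single m c)
    have "Q * single m c = single 0 c * (Q * single m 1)"
      by (metis (no_types) mult.left_commute mult_single add_0 mult.right_neutral)
    then show ?case using mono[OF assms(1,2), of m] by (simp add: vol_def lin_eval_const_mult)
  qed (simp add: distrib_left vol_add)
  then show ?thesis by (simp add: Q_def J_def)
qed

lemma finite_rflats_such_that: "finite {G. rflat E r G \<and> P G}"
  by (rule finite_subset[OF _ finite_rflats]) auto

lemma h_expansion:
  assumes "F \<noteq> {}" "rflat E r F" "F \<subseteq> K" "rflat E r K"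
  shows "Xv F - Xv K = - (\<Sum>G | rflat E r G \<and> F \<subseteq> G \<and> \<not> K \<subseteq> G. X G)"
proof -
  have "{G. rflat E r G \<and> F \<subseteq> G} =
      {G. rflat E r G \<and> F \<subseteq> G \<and> \<not> K \<subseteq> G} \<union> {G. rflat E r G \<and> K \<subseteq> G}" using assms(3) by auto
  then have "(\<Sum>G | rflat E r G \<and> F \<subseteq> G. X G) =
      (\<Sum>G | rflat E r G \<and> F \<subseteq> G \<and> \<not> K \<subseteq> G. X G) + (\<Sum>G | rflat E r G \<and> K \<subseteq> G. X G)"
    by (simp only:) (rule sum.union_disjoint, auto intro: finite_rflats_such_that)
  then have "- Xv F = (\<Sum>G | rflat E r G \<and> F \<subseteq> G \<and> \<not> K \<subseteq> G. X G) - Xv K"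
    using sum_X[of F] sum_X[of K] assms by auto
  then show ?thesis by (simp add: algebra_simps)
qed

text \<open>With J the join, (h_F - h_J)(h_G - h_J) expands into terms x_K x_L with K above F, L
  above G, and neither above J. Then K misses part of G and L misses part of F, so K and L are again
  incomparable. All pairs except (F, G) have smaller complements and vanish by induction, hence so
  does x_F x_G.\<close>

lemma vol_incomparable:
  assumes r': "rank_function E r'" "rank_quotient r r'"
    and "rflat E r F" "rflat E r G" "\<not> F \<subseteq> G" "\<not> G \<subseteq> F"
  shows "vol E r' (X F * X G * p) = 0"
  using assms(3-)
proof (induction "card (E - F) + card (E - G)" arbitrary: F G rule: less_induct)
  case less
  note FG = less.prems
  then have ne: "F \<noteq> {}" "G \<noteq> {}" and sub: "F \<subseteq> E" "G \<subseteq> E" by (auto simp: rflat_def)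
  define J where "J = closure E r (F \<union> G)"
  have J: "rflat E r J" "F \<subseteq> J" "G \<subseteq> J"
    using subset_closure[of "F \<union> G"] rflat_closure[of "F \<union> G"] sub by (auto simp: J_def)
  have J_sub: "J \<subseteq> K \<longleftrightarrow> F \<subseteq> K \<and> G \<subseteq> K" if "rflat E r K" for K
    using J closure_least[OF that, of "F \<union> G"] by (auto simp: J_def)
  define A where "A = {K. rflat E r K \<and> F \<subseteq> K \<and> \<not> J \<subseteq> K}"
  define B where "B = {K. rflat E r K \<and> G \<subseteq> K \<and> \<not> J \<subseteq> K}"
  have AB: "finite (A \<times> B)" by (auto simp: A_def B_def intro: finite_rflats_such_that)
  have "(Xv F - Xv J) * (Xv G - Xv J) = (\<Sum>K\<in>A. X K) * (\<Sum>L\<in>B. X L)"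
    using h_expansion[OF ne(1) FG(1) J(2,1)] h_expansion[OF ne(2) FG(2) J(3,1)]
    by (simp add: A_def B_def)
  also have "\<dots> = (\<Sum>(K, L)\<in>A \<times> B. X K * X L)"
    by (simp add: sum_product sum.cartesian_product)
  finally have "vol E r' ((\<Sum>(K, L)\<in>A \<times> B. X K * X L) * p) = 0"
    using vol_h_quadratic[OF r' ne(1) sub(1) ne(2) sub(2), of p] by (simp add: J_def)
  then have "(\<Sum>(K, L)\<in>A \<times> B. vol E r' (X K * X L * p)) = 0"
    by (simp add: sum_distrib_right vol_sum case_prod_unfold)
  moreover have "(F, G) \<in> A \<times> B" using FG J_sub by (auto simp: A_def B_def)
  then have "(\<Sum>(K, L)\<in>A \<times> B. vol E r' (X K * X L * p)) =
      vol E r' (X F * X G * p) + (\<Sum>(K, L)\<in>A \<times> B - {(F, G)}. vol E r' (X K * X L * p))"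
    using sum.remove[OF AB, of "(F, G)" "\<lambda>(K, L). vol E r' (X K * X L * p)"] by simp
  moreover have "(\<Sum>(K, L)\<in>A \<times> B - {(F, G)}. vol E r' (X K * X L * p)) = 0"
  proof (rule sum.neutral, rule ballI)
    fix z assume z: "z \<in> A \<times> B - {(F, G)}"
    obtain K L where zKL: "z = (K, L)" by (cases z)
    with z have KL: "K \<in> A" "L \<in> B" "\<not> (K = F \<and> L = G)" by auto
    then have *: "rflat E r K" "F \<subseteq> K" "\<not> G \<subseteq> K" "rflat E r L" "G \<subseteq> L" "\<not> F \<subseteq> L"
      using J_sub by (auto simp: A_def B_def)
    have le: "card (E - K) \<le> card (E - F)" "card (E - L) \<le> card (E - G)"
      using * fin by (auto intro!: card_mono)
    have "card (E - K) < card (E - F) \<or> card (E - L) < card (E - G)"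
    proof (cases "K = F")
      case True
      then have "E - L \<subset> E - G" using KL * by (auto simp: rflat_def)
      then show ?thesis using fin by (auto intro: psubset_card_mono)
    next
      case False
      then have "E - K \<subset> E - F" using * by (auto simp: rflat_def)
      then show ?thesis using fin by (auto intro: psubset_card_mono)
    qed
    then have "card (E - K) + card (E - L) < card (E - F) + card (E - G)" using le by linarith
    then have "vol E r' (X K * X L * p) = 0" using * by (intro less.hyps) auto
    then show "(case z of (K, L) \<Rightarrow> vol E r' (X K * X L * p)) = 0" by (simp add: zKL)
  qed
  ultimately show ?case by simp
qed

lemma sum_X_containing:
  assumes "x \<in> E"
  shows "(\<Sum>G | rflat E r G \<and> x \<in> G. X G) = - Xv (closure E r {x})"
proof -
  have "x \<in> closure E r {x}" using subset_closure[of "{x}"] assms by auto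
  then have "{G. rflat E r G \<and> x \<in> G} = {G. rflat E r G \<and> closure E r {x} \<subseteq> G}"
    using closure_least[of _ "{x}"] by auto
  then show ?thesis using sum_X[OF rflat_closure, of "{x}"] \<open>x \<in> closure E r {x}\<close> by auto
qed

text \<open>Subtracting the vanishing class of the atom through \<open>x\<close> rewrites h_F as a
  sum of x_G with G through \<open>x\<close>. The point may be chosen freely in \<open>F\<close>,
  and the later proofs choose it so that few terms survive.\<close>

lemma vol_h_expansion:
  assumes "rank_function E r'" "rank_quotient r r'" "rflat E r F" "x \<in> F"
  shows "vol E r' (Xv F * p) = (\<Sum>G | rflat E r G \<and> x \<in> G \<and> \<not> F \<subseteq> G. vol E r' (X G * p))"
proof -
  have x: "x \<in> E" using assms by (auto simp: rflat_def)
  have xc: "x \<in> closure E r {x}" "closure E r {x} \<subseteq> F"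
    using subset_closure[of "{x}"] closure_least[OF assms(3), of "{x}"] x assms(4) by auto
  have "{G. rflat E r G \<and> closure E r {x} \<subseteq> G \<and> \<not> F \<subseteq> G} = {G. rflat E r G \<and> x \<in> G \<and> \<not> F \<subseteq> G}"
    using xc closure_least[of _ "{x}"] by auto
  moreover have "closure E r {x} \<noteq> {}" using xc(1) by auto
  ultimately have "Xv (closure E r {x}) - Xv F = - (\<Sum>G | rflat E r G \<and> x \<in> G \<and> \<not> F \<subseteq> G. X G)"
    using h_expansion[OF _ rflat_closure xc(2) assms(3)] by simp
  then have "Xv F = Xv (closure E r {x}) + (\<Sum>G | rflat E r G \<and> x \<in> G \<and> \<not> F \<subseteq> G. X G)"
    by (simp add: algebra_simps)
  then have "vol E r' (Xv F * p) = vol E r' (Xv (closure E r {x}) * p) +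
      vol E r' ((\<Sum>G | rflat E r G \<and> x \<in> G \<and> \<not> F \<subseteq> G. X G) * p)"
    by (simp add: distrib_right vol_add)
  then show ?thesis
    using vol_h_closure_singleton[OF assms(1,2) x] by (simp add: sum_distrib_right vol_sum)
qed

text \<open>Induction over the truncations. The new case is an \<open>H\<close> that is flat before
  truncating along \<open>F\<close> but not after: then H and F together have rank one more than
  \<open>H\<close>. Expand h_F at a point \<open>y\<close> of \<open>F\<close> outside
  \<open>H\<close>. A flat K of \<open>r'\<close> above \<open>H\<close> and through
  \<open>y\<close> would contain \<open>F\<close>, so every surviving index is incomparable with
  \<open>H\<close>.\<close>

lemma vol_nonflat:
  assumes "iter_trunc E r r'" "rflat E r H" "\<not> rflat E r' H"
  shows "vol E r' (X H * p) = 0"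
  using assms
proof (induction arbitrary: H p)
  case base
  then show ?case by simp
next
  case (step r' F)
  note r' = iter_truncD(1,2)[OF step.hyps(1)]
  then interpret r': rank_function E r' by simp
  have "vol E (trunc F r') (X H * p) = vol E r' (Xv F * (X H * p))"
    by (simp add: vol_Xv_mult[OF r'(1)])
  also have "\<dots> = 0"
  proof (cases "rflat E r' H")
    case False
    then show ?thesis using step.IH[OF step.prems(1), of "Xv F * p"] by (simp add: ac_simps)
  next
    case True
    have F1: "1 \<le> r' (A \<union> F)" for A using r'.mono[of F "A \<union> F"] step.hyps(3) by simp
    obtain x where x: "x \<in> E - H" "trunc F r' (insert x H) \<le> trunc F r' H"
      using step.prems by (auto simp: rflat_def not_less)
    have lt: "r' H < r' (insert x H)" using True x by (simp add: rflat_def)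
    have nF: "\<not> F \<subseteq> H"
    proof
      assume "F \<subseteq> H"
      then have "H \<union> F = H" "insert x H \<union> F = insert x H" by auto
      then show False using x(2) lt F1[of H] by (simp add: trunc_def)
    qed
    then obtain y where y: "y \<in> F" "y \<in> E" "y \<notin> H" using step.hyps(2) by (auto simp: rflat_def)
    \<comment> \<open>Failure of flatness at \<open>x\<close> means that adding \<open>F\<close>
      raises the rank of \<open>H\<close> by at most one; the point \<open>y\<close> uses this up,
      so \<open>insert y H\<close> spans \<open>F\<close>.\<close>
    have "trunc F r' H \<le> r' H" by (simp add: trunc_def)
    then have "r' (insert x H \<union> F) \<le> Suc (r' H)"
      using x(2) lt F1[of "insert x H"] by (auto simp: trunc_def min_def split: if_splits)
    moreover have "r' (insert y H \<union> F) \<le> r' (insert x H \<union> F)" using y by (intro r'.mono) auto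
    moreover have "r' H < r' (insert y H)" using True y by (simp add: rflat_def)
    ultimately have yF: "r' (insert y H \<union> F) \<le> r' (insert y H)" by simp
    show ?thesis
      unfolding vol_h_expansion[OF r' step.hyps(2) y(1)]
    proof (rule sum.neutral, rule ballI)
      fix K assume "K \<in> {G. rflat E r G \<and> y \<in> G \<and> \<not> F \<subseteq> G}"
      then have K: "rflat E r K" "y \<in> K" "\<not> F \<subseteq> K" by simp_all
      show "vol E r' (X K * (X H * p)) = 0"
      proof (cases "rflat E r' K")
        case False
        then show ?thesis by (rule step.IH[OF K(1)])
      next
        case K': True
        have "\<not> H \<subseteq> K"
        proof
          assume "H \<subseteq> K"
          then have sub: "insert y H \<subseteq> K" using K by simp
          have "r' (insert y H \<union> F) = r' (insert y H)"
            by (intro antisym yF r'.mono) auto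
          from r'.union_eq_mono[OF sub this] have "F \<subseteq> K"
            using step.hyps(2) by (intro r'.rflat_unionD[OF K']) (auto simp: rflat_def)
          with K show False by simp
        qed
        moreover have "\<not> K \<subseteq> H" using K y by auto
        ultimately show ?thesis
          using vol_incomparable[OF r' K(1) step.prems(1)] by (simp add: mult.assoc)
      qed
    qed
  qed
  finally show ?case .
qed

text \<open>Truncation along the second flat \<open>G2\<close> removes the lowest flat of a complete
  flag: expand the class h of \<open>G2\<close> at a point of \<open>G1\<close>. Another flat
  through this point that is still flat in \<open>r'\<close> and does not contain \<open>G2\<close>
  is incomparable with \<open>G2\<close>, so only the term of \<open>G1\<close> survives.\<close>

lemma vol_flag:
  assumes "iter_trunc E r r'" "finite \<tau>"
    and "\<And>F. F \<in> \<tau> \<Longrightarrow> rflat E r' F \<and> F \<noteq> {} \<and> F \<noteq> E"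
    and "\<And>F G. F \<in> \<tau> \<Longrightarrow> G \<in> \<tau> \<Longrightarrow> F \<subseteq> G \<or> G \<subseteq> F"
    and "Suc (card \<tau>) = r' E"
  shows "vol E r' (\<Prod>F\<in>\<tau>. X F) = 1"
  using assms
proof (induction "card \<tau>" arbitrary: \<tau> r')
  case 0
  then have "\<tau> = {}" "r' E = 1" by auto
  then show ?case using iter_truncD(3)[OF 0(2)] by (simp add: vol_one)
next
  case (Suc n)
  note it = Suc.prems(1) and flats = Suc.prems(3) and chain = Suc.prems(4)
  note r' = iter_truncD[OF it]
  interpret r': rank_function E r' by (rule r'(1))
  have sub: "K \<subseteq> E" if "K \<in> \<tau>" for K using flats[OF that] by (simp add: rflat_def)
  have chainE: "K \<subseteq> L \<or> L \<subseteq> K" if "K \<in> insert E \<tau>" "L \<in> insert E \<tau>" for K L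
    using that chain[of K L] sub[of K] sub[of L] by blast
  have "\<tau> \<noteq> {}" using Suc.hyps(2) by auto
  then have "\<exists>m\<in>\<tau>. \<forall>K\<in>\<tau>. m \<subseteq> K"
    using chain by (intro finite_chain_least Suc.prems(2)) auto
  then obtain G1 where G1: "G1 \<in> \<tau>" "\<And>K. K \<in> \<tau> \<Longrightarrow> G1 \<subseteq> K" by blast
  define \<tau>' where "\<tau>' = \<tau> - {G1}"
  have fin': "finite \<tau>'" and card': "card \<tau>' = n" and E': "E \<notin> \<tau>"
    using Suc.prems(2) Suc.hyps(2) G1(1) flats[of E] by (auto simp: \<tau>'_def)
  have "\<forall>K\<in>insert E \<tau>'. \<forall>L\<in>insert E \<tau>'. K \<subseteq> L \<or> L \<subseteq> K"
  proof (intro ballI)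
    fix K L assume "K \<in> insert E \<tau>'" "L \<in> insert E \<tau>'"
    then show "K \<subseteq> L \<or> L \<subseteq> K" by (intro chainE) (auto simp: \<tau>'_def)
  qed
  then have "\<exists>m\<in>insert E \<tau>'. \<forall>K\<in>insert E \<tau>'. m \<subseteq> K"
    by (intro finite_chain_least) (simp_all add: fin')
  \<comment> \<open>\<open>G2\<close> is the next flat above \<open>G1\<close>, or \<open>E\<close>
    if the flag has only one member. Counting the chain above it forces \<open>r' G1 = 1\<close> and
    \<open>r' G2 = 2\<close>.\<close>
  then obtain G2 where G2: "G2 \<in> insert E \<tau>'" "\<And>K. K \<in> insert E \<tau>' \<Longrightarrow> G2 \<subseteq> K"
    by blast
  have f2: "rflat E r' G2" using G2 flats r'.rflat_ground by (auto simp: \<tau>'_def)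
  have f1: "rflat E r' G1" "G1 \<noteq> {}" "G1 \<subseteq> E" using flats[OF G1(1)] sub[OF G1(1)] by auto
  have "G1 \<noteq> E" using flats[OF G1(1)] by simp
  then have G12: "G1 \<subset> G2" using G2(1) G1 f1 by (auto simp: \<tau>'_def)
  have "card (insert E \<tau>' - {G2}) = n" using G2(1) fin' card' E' by (simp add: \<tau>'_def)
  moreover have "r' G2 + card (insert E \<tau>' - {G2}) \<le> r' E"
  proof (rule r'.chain_card_le)
    show "rflat E r' K \<and> G2 \<subset> K" if "K \<in> insert E \<tau>' - {G2}" for K
      using that G2(2)[of K] flats r'.rflat_ground by (auto simp: \<tau>'_def)
    show "K \<subseteq> L \<or> L \<subseteq> K" if "K \<in> insert E \<tau>' - {G2}" "L \<in> insert E \<tau>' - {G2}" for K L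
      using that by (intro chainE) (auto simp: \<tau>'_def)
  qed (use fin' f2 in auto)
  ultimately have "r' G2 \<le> 2" using Suc.prems(5) Suc.hyps(2) by simp
  obtain x where x: "x \<in> G1" "x \<in> E" using f1 by auto
  have "r' {x} = 1" using r'(3) x by simp
  have "r' G1 < r' G2" using r'.rflat_psubset_less[OF f1(1) _ G12] f2 by (simp add: rflat_def)
  moreover have "1 \<le> r' G1" using r'.mono[of "{x}" G1] x \<open>r' {x} = 1\<close> by simp
  ultimately have rG: "r' G2 = 2" "r' G1 = 1" using \<open>r' G2 \<le> 2\<close> by auto
  have rank1: "closure E r' {x} = H" if "rflat E r' H" "x \<in> H" "r' H \<le> 1" for H
  proof (rule ccontr)
    assume "closure E r' {x} \<noteq> H"
    then have "closure E r' {x} \<subset> H" using r'.closure_least[OF that(1), of "{x}"] that(2) by auto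
    then have "r' {x} < r' H"
      using r'.rflat_psubset_less[OF r'.rflat_closure] that(1) r'.rank_closure by (auto simp: rflat_def)
    then show False using \<open>r' {x} = 1\<close> that(3) by simp
  qed
  have base1: "rflat E r G1" "rflat E r G2"
    using rank_quotient_rflat[OF r'(2)] f1 f2 by auto
  have "vol E (trunc G2 r') (\<Prod>F\<in>\<tau>'. X F) = vol E r' (Xv G2 * (\<Prod>F\<in>\<tau>'. X F))"
    by (simp add: vol_Xv_mult[OF r'(1)])
  also have "\<dots> = (\<Sum>H | rflat E r H \<and> x \<in> H \<and> \<not> G2 \<subseteq> H. vol E r' (X H * (\<Prod>F\<in>\<tau>'. X F)))"
    using G12 x by (intro vol_h_expansion r' base1) auto
  also have "\<dots> = (\<Sum>H\<in>{G1}. vol E r' (X H * (\<Prod>F\<in>\<tau>'. X F)))"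
  proof (rule sum.mono_neutral_right)
    show "{G1} \<subseteq> {H. rflat E r H \<and> x \<in> H \<and> \<not> G2 \<subseteq> H}" using base1 x G12 by auto
    show "\<forall>H\<in>{H. rflat E r H \<and> x \<in> H \<and> \<not> G2 \<subseteq> H} - {G1}. vol E r' (X H * (\<Prod>F\<in>\<tau>'. X F)) = 0"
    proof (rule ballI)
      fix H assume "H \<in> {H. rflat E r H \<and> x \<in> H \<and> \<not> G2 \<subseteq> H} - {G1}"
      then have H: "rflat E r H" "x \<in> H" "\<not> G2 \<subseteq> H" "H \<noteq> G1" by simp_all
      show "vol E r' (X H * (\<Prod>F\<in>\<tau>'. X F)) = 0"
      proof (cases "rflat E r' H")
        case False
        then show ?thesis by (rule vol_nonflat[OF it H(1)])
      next
        case True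
        have "\<not> H \<subseteq> G2"
        proof
          assume "H \<subseteq> G2"
          then have "H \<subset> G2" "G2 \<subseteq> E" using H f2 by (auto simp: rflat_def)
          then have "r' H \<le> 1" using r'.rflat_psubset_less[OF True _ \<open>H \<subset> G2\<close>] rG by simp
          then show False using rank1[OF True H(2)] rank1[OF f1(1) x(1)] rG H(4) by simp
        qed
        then have K: "G2 \<in> \<tau>'" using G2(1) H(1) by (auto simp: rflat_def)
        then have "(\<Prod>F\<in>\<tau>'. X F) = X G2 * (\<Prod>F\<in>\<tau>' - {G2}. X F)" using fin' by (simp add: prod.remove)
        then show ?thesis
          using vol_incomparable[OF r'(1,2) H(1) base1(2) \<open>\<not> H \<subseteq> G2\<close> H(3)] by (simp add: mult.assoc)
      qed
    qed
  qed (rule finite_rflats_such_that)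
  also have "\<dots> = vol E r' (\<Prod>F\<in>\<tau>. X F)"
    using prod.remove[OF Suc.prems(2) G1(1), of X] by (simp add: \<tau>'_def)
  finally have eq: "vol E r' (\<Prod>F\<in>\<tau>. X F) = vol E (trunc G2 r') (\<Prod>F\<in>\<tau>'. X F)" by simp
  have "vol E (trunc G2 r') (\<Prod>F\<in>\<tau>'. X F) = 1"
  proof (rule Suc.hyps(1))
    show "n = card \<tau>'" by (simp add: card')
    show "iter_trunc E r (trunc G2 r')" using rG by (intro iter_trunc.step[OF it base1(2)]) simp
    show "Suc (card \<tau>') = trunc G2 r' E"
      using card' Suc.prems(5) Suc.hyps(2) by (simp add: r'.trunc_ground)
    show "rflat E (trunc G2 r') F \<and> F \<noteq> {} \<and> F \<noteq> E" if "F \<in> \<tau>'" for F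
      using that G2(2)[of F] flats[of F] rG by (auto simp: \<tau>'_def intro!: r'.trunc_rflat)
    show "F \<subseteq> G \<or> G \<subseteq> F" if "F \<in> \<tau>'" "G \<in> \<tau>'" for F G
      using that chain by (auto simp: \<tau>'_def)
  qed (rule fin')
  with eq show ?case by simp
qed

text \<open>Here the Bergman class of a truncation appears: on chains of \<open>r' E - 1\<close>
  proper nonempty flats of \<open>r\<close>, the value is the indicator of the flags of
  \<open>r'\<close>.\<close>

lemma vol_chain:
  assumes "iter_trunc E r r'" "finite \<sigma>"
    and "\<And>F. F \<in> \<sigma> \<Longrightarrow> rflat E r F \<and> F \<noteq> {} \<and> F \<noteq> E"
    and "\<And>F G. F \<in> \<sigma> \<Longrightarrow> G \<in> \<sigma> \<Longrightarrow> F \<subseteq> G \<or> G \<subseteq> F"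
    and "Suc (card \<sigma>) = r' E"
  shows "vol E r' (\<Prod>F\<in>\<sigma>. X F) = (if \<forall>F\<in>\<sigma>. rflat E r' F then 1 else 0)"
proof (cases "\<forall>F\<in>\<sigma>. rflat E r' F")
  case True
  then show ?thesis using vol_flag[OF assms(1,2)] assms(3-) by auto
next
  case False
  then obtain F where F: "F \<in> \<sigma>" "\<not> rflat E r' F" by auto
  then have "vol E r' (X F * (\<Prod>F\<in>\<sigma> - {F}. X F)) = 0"
    using assms(3) by (intro vol_nonflat[OF assms(1)]) auto
  then show ?thesis using False prod.remove[OF assms(2) F(1), of X] by simp
qed

end

subsection \<open>Uniqueness of the degree functional\<close>

lemma lin_eval_diff_weight: "lin_eval (\<lambda>m. v m - w m) p = lin_eval v p - lin_eval w p"
  by (simp add: lin_eval_def right_diff_distrib sum_subtractf)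

lemma ideal_genI: "g \<in> G \<Longrightarrow> q * g \<in> ideal_gen G"
  unfolding ideal_gen_def by (intro CollectI exI[of _ "{g}"] exI[of _ "\<lambda>_. q"]) auto

lemma of_int_mult_single: "of_int z * single m (c :: real) = single m (of_int z * c)"
  using mult_single[of 0 "real_of_int z" m c] by simp

lemma expo_keys:
  assumes "\<And>F. F \<in> keys m \<Longrightarrow> lookup m F = 1"
  shows "expo (keys m) = m"
proof (rule poly_mapping_eqI)
  fix F show "lookup (expo (keys m)) F = lookup m F"
    using assms[of F] by (simp add: expo_def lookup_sum lookup_single when_def sum.delta in_keys_iff)
qed

lemma finite_rays: "finite E \<Longrightarrow> finite (rays E I)"
  by (rule finite_subset[of _ "Pow E"]) (auto simp: rays_def flat_def)

text \<open>A monomial supported on a chain, but not squarefree, is rewritten with larger support by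
  the relation of a coroot \<open>e\<^sub>i - e\<^sub>j\<close> separating a repeated flat from its neighbours in the chain.\<close>
lemma weight_determined:
  assumes fin: "finite E"
    and supp: "\<And>m. mdeg m \<noteq> l \<or> \<not> keys m \<subseteq> rays E I \<Longrightarrow> u m = 0"
    and cone: "\<And>\<tau>. kcone E I l \<tau> \<Longrightarrow> u (expo \<tau>) = 0"
    and ideal: "\<And>p. p \<in> chow_ideal E I \<Longrightarrow> lin_eval u p = 0"
  shows "u m = 0"
proof (induction "card (rays E I) - card (keys m)" arbitrary: m rule: less_induct)
  case less
  show ?case
  proof (cases "mdeg m = l \<and> keys m \<subseteq> rays E I")
    case False
    then show ?thesis using supp by blast
  next
    case True
    then have deg: "mdeg m = l" and rays: "keys m \<subseteq> rays E I" by auto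
    have peel: "m = single F 1 + (m - single F 1)" if "F \<in> keys m" for F
      by (rule poly_mapping_eqI)
        (use that in \<open>auto simp: lookup_add lookup_minus lookup_single when_def in_keys_iff\<close>)
    show ?thesis
    proof (cases "\<forall>F\<in>keys m. \<forall>G\<in>keys m. F \<subseteq> G \<or> G \<subseteq> F")
      case False
      then obtain F G where FG: "F \<in> keys m" "G \<in> keys m" "\<not> F \<subseteq> G" "\<not> G \<subseteq> F" by auto
      define k where "k = m - single F 1 - single G 1"
      have "expo {F, G} = single F 1 + single G 1" using FG by (simp add: expo_def)
      moreover have "m = single F 1 + single G 1 + k"
        unfolding k_def
        by (rule poly_mapping_eqI)
          (use FG in \<open>auto simp: lookup_add lookup_minus lookup_single when_def in_keys_iff\<close>)
      ultimately have "single k 1 * xmono {F, G} = single m 1"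
        by (simp add: xmono_def mult_single add.commute)
      moreover have "single k 1 * xmono {F, G} \<in> chow_ideal E I"
        unfolding chow_ideal_def using FG rays by (intro ideal_genI) blast
      ultimately have "single m 1 \<in> chow_ideal E I" by simp
      then have "lin_eval u (single m 1) = 0" by (rule ideal)
      then show ?thesis by simp
    next
      case chain: True
      show ?thesis
      proof (cases "\<exists>F\<in>keys m. lookup m F \<noteq> 1")
        case False
        then have "expo (keys m) = m" by (intro expo_keys) auto
        moreover have "card (keys m) = l" using False deg by (simp add: mdeg_def)
        then have "kcone E I l (keys m)" using chain rays by (simp add: kcone_def)
        ultimately show ?thesis using cone by metis
      next
        case True
        then obtain F where F: "F \<in> keys m" "lookup m F \<noteq> 1" by auto
        then have F2: "lookup m F \<ge> 2" by (simp add: in_keys_iff)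
        have FE: "F \<subset> E" "F \<noteq> {}" using F rays by (auto simp: rays_def flat_def)
        \<comment> \<open>\<open>i\<close> avoids the largest member of the chain below
          \<open>F\<close>, and dually \<open>j\<close> lies in the smallest member above
          \<open>F\<close>. Inserting {} and \<open>E\<close> covers an \<open>F\<close> at an end
          of the chain.\<close>
        obtain i where i: "i \<in> F" "\<And>H. H \<in> keys m \<Longrightarrow> i \<in> H \<Longrightarrow> F \<subseteq> H"
        proof -
          let ?P = "insert {} {H \<in> keys m. H \<subset> F}"
          have P: "finite ?P" "?P \<noteq> {}" by simp_all
          have chainP: "\<forall>K\<in>?P. \<forall>L\<in>?P. K \<subseteq> L \<or> L \<subseteq> K"
            using chain by blast
          obtain M where M: "M \<in> ?P" "\<forall>H\<in>?P. H \<subseteq> M"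
            using finite_chain_greatest[OF P chainP] by (elim bexE)
          have "M \<subset> F" using M(1) FE by auto
          then obtain i where i: "i \<in> F" "i \<notin> M" by auto
          have "F \<subseteq> H" if "H \<in> keys m" "i \<in> H" for H
          proof (rule ccontr)
            assume "\<not> F \<subseteq> H"
            then have "H \<in> ?P" using chain that F by blast
            then show False using M(2) that(2) i(2) by blast
          qed
          with i(1) show ?thesis by (rule that)
        qed
        obtain j where j: "j \<in> E" "j \<notin> F" "\<And>H. H \<in> keys m \<Longrightarrow> F \<subset> H \<Longrightarrow> j \<in> H"
        proof -
          let ?P = "insert E {H \<in> keys m. F \<subset> H}"
          have sub: "H \<subseteq> E" if "H \<in> keys m" for H using that rays by (auto simp: rays_def flat_def)
          have P: "finite ?P" "?P \<noteq> {}" by simp_all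
          have chainP: "\<forall>K\<in>?P. \<forall>L\<in>?P. K \<subseteq> L \<or> L \<subseteq> K"
            using chain sub by blast
          obtain M where M: "M \<in> ?P" "\<forall>H\<in>?P. M \<subseteq> H"
            using finite_chain_least[OF P chainP] by (elim bexE)
          have "F \<subset> M" using M(1) FE by auto
          then obtain j where j: "j \<in> M" "j \<notin> F" by auto
          have "j \<in> H" if "H \<in> keys m" "F \<subset> H" for H using M(2) that j by blast
          moreover have "j \<in> E" using M(2) j by blast
          ultimately show ?thesis using that j(2) by blast
        qed
        define k where "k = m - single F 1"
        have m: "m = single F 1 + k" unfolding k_def by (rule peel[OF F(1)])
        have "F \<in> keys k" using F2 by (simp add: k_def in_keys_iff lookup_minus)
        then have keys_k: "keys k = keys m" by (auto simp: m keys_add_nat)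
        define f where "f x = (if x = i then 1 else 0) - (if x = j then 1 else (0::int))" for x
        have iE: "i \<in> E" "i \<noteq> j" using i(1) j(2) FE by auto
        have "(\<Sum>x\<in>E. f x) = 0" using iE j(1) fin by (simp add: f_def sum_subtractf)
        then have "single k 1 * linrel E I f \<in> chow_ideal E I"
          unfolding chow_ideal_def by (intro ideal_genI) blast
        then have rel: "lin_eval u (single k 1 * linrel E I f) = 0" by (rule ideal)
        have term_eq: "single k 1 * (of_int z * Xv H) = single (single H 1 + k) (of_int z)" for z H
          by (simp add: Xv_def of_int_mult_single mult_single add.commute)
        have "single k 1 * linrel E I f =
            (\<Sum>H\<in>rays E I. single (single H 1 + k) (of_int (\<Sum>x\<in>H. f x)))"
          unfolding linrel_def sum_distrib_left by (simp only: term_eq)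
        with rel have "(\<Sum>H\<in>rays E I. of_int (\<Sum>x\<in>H. f x) * u (single H 1 + k)) = 0"
          by (simp add: lin_eval_sum)
        moreover have "(\<Sum>H\<in>rays E I. of_int (\<Sum>x\<in>H. f x) * u (single H 1 + k)) =
            (\<Sum>H\<in>{F}. of_int (\<Sum>x\<in>H. f x) * u (single H 1 + k))"
        proof (rule sum.mono_neutral_right)
          show "finite (rays E I)" by (rule finite_rays[OF fin])
          show "{F} \<subseteq> rays E I" using F rays by auto
          \<comment> \<open>Members of the chain other than \<open>F\<close> contain both points or
            neither, so their coefficient is 0; a ray outside the support enlarges it, so the
            induction hypothesis applies.\<close>
          show "\<forall>H\<in>rays E I - {F}. of_int (\<Sum>x\<in>H. f x) * u (single H 1 + k) = 0"
          proof
            fix H assume H: "H \<in> rays E I - {F}"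
            then have finH: "finite H" using fin by (auto simp: rays_def flat_def intro: finite_subset)
            show "of_int (\<Sum>x\<in>H. f x) * u (single H 1 + k) = 0"
            proof (cases "H \<in> keys m")
              case True
              have "i \<in> H \<longleftrightarrow> j \<in> H"
                using i(1) i(2)[OF True] j(2) j(3)[OF True] chain True F(1) H by blast
              then have "(\<Sum>x\<in>H. f x) = 0" using finH by (simp add: f_def sum_subtractf)
              then show ?thesis by simp
            next
              case False
              have k': "keys (single H 1 + k) = insert H (keys m)" by (auto simp: keys_add_nat keys_k)
              have "insert H (keys m) \<subseteq> rays E I" using H rays by auto
              then have "card (insert H (keys m)) \<le> card (rays E I)"
                by (rule card_mono[OF finite_rays[OF fin]])
              moreover have "card (insert H (keys m)) = Suc (card (keys m))" using False by simp
              ultimately have "card (rays E I) - card (keys (single H 1 + k)) < card (rays E I) - card (keys m)"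
                unfolding k' by linarith
              then have "u (single H 1 + k) = 0" by (rule less.hyps)
              then show ?thesis by simp
            qed
          qed
        qed
        moreover have "(\<Sum>x\<in>F. f x) = 1"
        proof -
          have "finite F" using FE fin finite_subset by auto
          then show ?thesis using i(1) j(2) by (simp add: f_def sum_subtractf)
        qed
        ultimately show ?thesis by (simp add: m)
      qed
    qed
  qed
qed

text \<open>Discharges the definite description: the difference of two candidates is a weight as in
  \<open>weight_determined\<close>.\<close>

lemma deg_fun_eqI:
  assumes fin: "finite E"
    and supp: "\<And>m. mdeg m \<noteq> l \<or> \<not> keys m \<subseteq> rays E I \<Longrightarrow> w m = 0"
    and cone: "\<And>\<tau>. kcone E I l \<tau> \<Longrightarrow> w (expo \<tau>) = \<Delta> \<tau>"
    and ideal: "\<And>p. p \<in> chow_ideal E I \<Longrightarrow> lin_eval w p = 0"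
  shows "deg_fun E I l \<Delta> = w"
  unfolding deg_fun_def
proof (rule the_equality)
  fix v
  assume v: "(\<forall>m. mdeg m \<noteq> l \<or> \<not> keys m \<subseteq> rays E I \<longrightarrow> v m = 0)
    \<and> (\<forall>\<tau>. kcone E I l \<tau> \<longrightarrow> v (expo \<tau>) = \<Delta> \<tau>) \<and> (\<forall>p\<in>chow_ideal E I. lin_eval v p = 0)"
  have "v m - w m = 0" for m
  proof (rule weight_determined[OF fin])
    show "v m - w m = 0" if "mdeg m \<noteq> l \<or> \<not> keys m \<subseteq> rays E I" for m
      using v supp[OF that] that by simp
    show "v (expo \<tau>) - w (expo \<tau>) = 0" if "kcone E I l \<tau>" for \<tau>
      using v cone[OF that] that by simp
    show "lin_eval (\<lambda>m. v m - w m) p = 0" if "p \<in> chow_ideal E I" for p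
      using v ideal[OF that] that by (simp add: lin_eval_diff_weight)
  qed
  then show "v = w" by (simp add: fun_eq_iff)
qed (use assms in blast)

section \<open>Existence of the degree functional\<close>

locale matroid_chow = chow_generators E "rk I" X
  for E :: "'a set" and I :: "'a set \<Rightarrow> bool" and X :: "'a set \<Rightarrow> 'a chowpoly"
begin

text \<open>\<open>deg_fun\<close> must vanish on monomials with non-ray variables. In particular
  \<open>Y\<close> drops \<open>E\<close>, for which \<open>X E\<close> is needed in the expansions
  but no Chow variable exists.\<close>

definition Y :: "'a set \<Rightarrow> 'a chowpoly" where
  "Y F = (if F \<in> rays E I then X F else 0)"

lemma rays_iff: "F \<in> rays E I \<longleftrightarrow> rflat E (rk I) F \<and> F \<noteq> {} \<and> F \<noteq> E"
  by (simp add: rays_def flat_eq_rflat)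

lemma homogeneous_Y: "homogeneous 1 (Y F)"
  using homogeneous_X[of F] by (cases "F \<in> rays E I") (simp_all add: Y_def)

lemma X_ground: "E \<noteq> {} \<Longrightarrow> X E = - Xv E"
proof -
  have "{G. rflat E (rk I) G \<and> E \<subseteq> G} = {E}" using rflat_ground by (auto simp: rflat_def)
  then show "E \<noteq> {} \<Longrightarrow> X E = - Xv E" using sum_X[OF rflat_ground] by simp
qed

text \<open>Non-faces contain an incomparable pair. In a linear relation, exchanging the sums over
  flats and points leaves a combination of h_E - h_a with a the atom of a point: the h_E terms
  cancel because the coefficients sum to 0, and the atoms vanish.\<close>

lemma vol_chow_ideal:
  assumes r': "rank_function E r'" "rank_quotient (rk I) r'" and "p \<in> chow_ideal E I"
  shows "vol E r' (subst Y p) = 0"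
proof -
  let ?G = "{xmono \<sigma> | \<sigma>. finite \<sigma> \<and> \<sigma> \<subseteq> rays E I \<and> \<not> (\<forall>F\<in>\<sigma>. \<forall>G\<in>\<sigma>. F \<subseteq> G \<or> G \<subseteq> F)}
      \<union> {linrel E I m | m. (\<Sum>i\<in>E. m i) = 0}"
  have gen: "vol E r' (q * subst Y g) = 0" if "g \<in> ?G" for g q
    using that
  proof
    assume "g \<in> {xmono \<sigma> | \<sigma>. finite \<sigma> \<and> \<sigma> \<subseteq> rays E I \<and> \<not> (\<forall>F\<in>\<sigma>. \<forall>G\<in>\<sigma>. F \<subseteq> G \<or> G \<subseteq> F)}"
    then obtain \<sigma> F G where \<sigma>: "g = xmono \<sigma>" "finite \<sigma>" "\<sigma> \<subseteq> rays E I"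
      and FG: "F \<in> \<sigma>" "G \<in> \<sigma>" "\<not> F \<subseteq> G" "\<not> G \<subseteq> F" by blast
    have "(\<Prod>H\<in>\<sigma>. Y H) = Y F * (Y G * (\<Prod>H\<in>\<sigma> - {F} - {G}. Y H))"
      using \<sigma> FG prod.remove[OF \<sigma>(2) FG(1), of Y] prod.remove[of "\<sigma> - {F}" G Y] by auto
    moreover have "Y F = X F" "Y G = X G" using FG \<sigma> by (auto simp: Y_def)
    ultimately have "q * subst Y g = X F * X G * (q * (\<Prod>H\<in>\<sigma> - {F} - {G}. Y H))"
      by (simp add: \<sigma>(1) ac_simps)
    moreover have "rflat E (rk I) F" "rflat E (rk I) G" using FG \<sigma>(3) by (auto simp: rays_iff)
    ultimately show ?thesis using vol_incomparable[OF r' _ _ FG(3,4)] by simp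
  next
    assume "g \<in> {linrel E I m | m. (\<Sum>i\<in>E. m i) = 0}"
    then obtain f where f: "g = linrel E I f" "(\<Sum>i\<in>E. f i) = 0" by blast
    have finR: "finite (rays E I)" by (rule finite_rays[OF fin])
    have "subst Y g = (\<Sum>F\<in>rays E I. of_int (\<Sum>i\<in>F. f i) * X F)"
      by (simp add: f(1) linrel_def subst_sum subst_mult Y_def)
    also have "\<dots> = (\<Sum>F\<in>rays E I. \<Sum>i\<in>E. if i \<in> F then of_int (f i) * X F else 0)"
    proof (intro sum.cong refl)
      fix F assume "F \<in> rays E I"
      then have "E \<inter> F = F" by (auto simp: rays_iff rflat_def)
      then show "of_int (\<Sum>i\<in>F. f i) * X F = (\<Sum>i\<in>E. if i \<in> F then of_int (f i) * X F else 0)"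
        using sum.inter_restrict[OF fin, of "\<lambda>i. of_int (f i) * X F" F] by (simp add: sum_distrib_right)
    qed
    also have "\<dots> = (\<Sum>i\<in>E. \<Sum>F\<in>rays E I. if i \<in> F then of_int (f i) * X F else 0)"
      by (rule sum.swap)
    also have "\<dots> = (\<Sum>i\<in>E. of_int (f i) * (Xv E - Xv (closure E (rk I) {i})))"
    proof (intro sum.cong refl)
      fix i assume i: "i \<in> E"
      then have ins: "{G. rflat E (rk I) G \<and> i \<in> G} = insert E {F \<in> rays E I. i \<in> F}"
        using rflat_ground by (auto simp: rays_iff)
      have "E \<notin> {F \<in> rays E I. i \<in> F}" by (simp add: rays_iff)
      then have "- Xv E + (\<Sum>F | F \<in> rays E I \<and> i \<in> F. X F) = - Xv (closure E (rk I) {i})"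
        using sum_X_containing[OF i] X_ground finR i unfolding ins
        by (cases "E = {}") auto
      then have "(\<Sum>F | F \<in> rays E I \<and> i \<in> F. X F) = Xv E - Xv (closure E (rk I) {i})"
        by (simp add: algebra_simps)
      moreover have "(\<Sum>F\<in>rays E I. if i \<in> F then of_int (f i) * X F else 0) =
          of_int (f i) * (\<Sum>F | F \<in> rays E I \<and> i \<in> F. X F)"
        using sum.inter_filter[OF finR, of "\<lambda>F. of_int (f i) * X F" "\<lambda>F. i \<in> F"]
        by (simp add: sum_distrib_left)
      ultimately show "(\<Sum>F\<in>rays E I. if i \<in> F then of_int (f i) * X F else 0) =
          of_int (f i) * (Xv E - Xv (closure E (rk I) {i}))" by simp
    qed
    also have "\<dots> = (\<Sum>i\<in>E. of_int (f i)) * Xv E - (\<Sum>i\<in>E. of_int (f i) * Xv (closure E (rk I) {i}))"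
      by (simp add: right_diff_distrib sum_subtractf sum_distrib_right)
    also have "(\<Sum>i\<in>E. of_int (f i)) = (0 :: 'a chowpoly)"
      using f(2) by (metis of_int_0 of_int_sum)
    finally have "q * subst Y g = - (\<Sum>i\<in>E. Xv (closure E (rk I) {i}) * (of_int (f i) * q))"
      by (simp add: sum_distrib_left ac_simps)
    then show ?thesis
      by (simp add: vol_uminus vol_sum vol_h_closure_singleton[OF r'])
  qed
  obtain S q where S: "S \<subseteq> ?G" "p = (\<Sum>g\<in>S. q g * g)"
    using assms(3) unfolding chow_ideal_def ideal_gen_def by blast
  have "vol E r' (subst Y p) = (\<Sum>g\<in>S. vol E r' (subst Y (q g) * subst Y g))"
    by (simp add: S(2) subst_sum subst_mult vol_sum)
  also have "\<dots> = 0"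
  proof (intro sum.neutral ballI)
    fix g assume "g \<in> S"
    with S(1) have "g \<in> ?G" by (rule subsetD)
    then show "vol E r' (subst Y (q g) * subst Y g) = 0" by (rule gen)
  qed
  finally show ?thesis .
qed

lemma deg_fun_bergman:
  assumes "rk I E = Suc d"
  shows "lin_eval (deg_fun E I d (bergman E I)) p = vol E (rk I) (subst Y p)"
proof -
  have "deg_fun E I d (bergman E I) = (\<lambda>m. vol E (rk I) (subst_mono Y m))"
  proof (rule deg_fun_eqI[OF fin])
    fix m assume m: "mdeg m \<noteq> d \<or> \<not> keys m \<subseteq> rays E I"
    show "vol E (rk I) (subst_mono Y m) = 0"
    proof (cases "mdeg m = d")
      case False
      then show ?thesis
        using homogeneous_subst_mono[OF homogeneous_Y] assms by (intro vol_homogeneous[of "mdeg m"]) auto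
    next
      case True
      then obtain F where F: "F \<in> keys m" "F \<notin> rays E I" using m by auto
      then have "Y F ^ lookup m F = 0" by (simp add: Y_def in_keys_iff power_0_left)
      then have "subst_mono Y m = 0" unfolding subst_mono_def using F(1) by (intro prod_zero) auto
      then show ?thesis by simp
    qed
  next
    fix \<tau> assume \<tau>: "kcone E I d \<tau>"
    have "subst_mono Y (expo \<tau>) = (\<Prod>F\<in>\<tau>. X F)"
      using \<tau> by (auto simp: expo_def subst_mono_sum Y_def kcone_def intro!: prod.cong)
    also have "vol E (rk I) \<dots> = 1"
      using \<tau> assms by (intro vol_flag iter_trunc.base) (auto simp: kcone_def rays_iff)
    finally show "vol E (rk I) (subst_mono Y (expo \<tau>)) = bergman E I \<tau>"
      using \<tau> assms by (simp add: bergman_def)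
  next
    fix p assume "p \<in> chow_ideal E I"
    then show "lin_eval (\<lambda>m. vol E (rk I) (subst_mono Y m)) p = 0"
      using vol_chow_ideal[OF rank_function_axioms rank_quotient_refl]
      by (simp add: vol_def lin_eval_subst)
  qed
  then show ?thesis by (simp add: vol_def lin_eval_subst)
qed

end

subsection \<open>Cyclic flats of quotients\<close>

text \<open>Equality of nullities is written additively so that it stays within natural
  numbers.\<close>

definition cyclic_rflat :: "'a set \<Rightarrow> ('a set \<Rightarrow> nat) \<Rightarrow> ('a set \<Rightarrow> nat) \<Rightarrow> 'a set \<Rightarrow> bool" where
  "cyclic_rflat E r r' F \<longleftrightarrow> rflat E r' F \<and>
     (\<forall>G. rflat E r' G \<and> G \<subset> F \<longrightarrow> r G + r' F \<noteq> r F + r' G)"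

lemma f_cyclic_flat_eq: "f_cyclic_flat E I' I F \<longleftrightarrow> cyclic_rflat E (rk I) (rk I') F"
proof -
  have "nullity I' I G \<noteq> nullity I' I F \<longleftrightarrow> rk I G + rk I' F \<noteq> rk I F + rk I' G" for G
    by (simp add: nullity_def) linarith
  then show ?thesis by (simp add: f_cyclic_flat_def cyclic_rflat_def flat_eq_rflat)
qed

lemma exists_cyclic_rflat:
  assumes "rank_function E r'" "rflat E r' G"
  shows "\<exists>F\<subseteq>G. cyclic_rflat E r r' F \<and> r F + r' G = r G + r' F"
proof -
  interpret r': rank_function E r' by fact
  let ?S = "{H. rflat E r' H \<and> H \<subseteq> G \<and> r H + r' G = r G + r' H}"
  have S: "finite ?S" by (rule finite_subset[OF _ r'.finite_rflats]) auto
  have ne: "?S \<noteq> {}" using assms(2) by auto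
  obtain F where F: "F \<in> ?S" "\<forall>H\<in>?S. H \<subseteq> F \<longrightarrow> F = H"
    using finite_has_minimal[OF S ne] by (elim bexE)
  have "r H + r' F \<noteq> r F + r' H" if "rflat E r' H" "H \<subset> F" for H
  proof
    assume eq: "r H + r' F = r F + r' H"
    have "r F + r' G = r G + r' F" "F \<subseteq> G" using F(1) by auto
    then have "H \<in> ?S" using eq that by auto
    with F(2) that(2) show False by auto
  qed
  then have "cyclic_rflat E r r' F" using F(1) by (auto simp: cyclic_rflat_def)
  with F(1) show ?thesis by auto
qed

text \<open>A quotient is recovered from its cyclic flats by
  \<open>r' A = Min {r (A \<union> F) - (r F - r' F) | F cyclic}\<close>.\<close>
lemma rank_le_of_cyclic_rflats:
  assumes "rank_function E r" "rank_function E r1" "rank_function E r2" "rank_quotient r r2"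
    and "\<And>F. cyclic_rflat E r r1 F \<Longrightarrow> r2 F \<le> r1 F"
  shows "r2 A \<le> r1 A"
proof -
  interpret r: rank_function E r by fact
  interpret r1: rank_function E r1 by fact
  interpret r2: rank_function E r2 by fact
  let ?G = "closure E r1 A"
  obtain F where F: "F \<subseteq> ?G" "cyclic_rflat E r r1 F" "r F + r1 ?G = r ?G + r1 F"
    using exists_cyclic_rflat[OF assms(2) r1.rflat_closure] by blast
  \<comment> \<open>With G the \<open>r1\<close>-closure of \<open>A\<close>, the chain is r2 A <=
    r2 F + r (A \<union> F) - r F <= r1 F + r G - r F = r1 G = r1 A.\<close>
  have "r2 (A \<union> F) + r F \<le> r (A \<union> F) + r2 F" by (rule rank_quotientD[OF assms(4)]) auto
  moreover have "r2 A \<le> r2 (A \<union> F)" by (rule r2.mono) auto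
  moreover have "r ((A \<union> F) \<inter> E) \<le> r ?G"
    using F(1) by (intro r.mono) (auto simp: closure_def insert_absorb)
  then have "r (A \<union> F) \<le> r ?G" by (simp add: r.Int_ground)
  moreover have "r2 F \<le> r1 F" by (rule assms(5)[OF F(2)])
  moreover have "r1 ?G = r1 A" by (rule r1.rank_closure)
  ultimately show ?thesis using F(3) by linarith
qed

lemma rank_eq_of_cyclic_rflats:
  assumes "rank_function E r" "rank_function E r1" "rank_function E r2"
    and "rank_quotient r r1" "rank_quotient r r2"
    and "\<And>F. cyclic_rflat E r r1 F \<longleftrightarrow> cyclic_rflat E r r2 F"
    and "\<And>F. cyclic_rflat E r r1 F \<Longrightarrow> r1 F = r2 F"
  shows "r1 = r2"
proof
  fix A
  have "r2 A \<le> r1 A"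
    by (rule rank_le_of_cyclic_rflats[OF assms(1-3,5)]) (simp add: assms(7))
  moreover have "r1 A \<le> r2 A"
    by (rule rank_le_of_cyclic_rflats[OF assms(1,3,2,4)]) (simp add: assms(6,7))
  ultimately show "r1 A = r2 A" by simp
qed

text \<open>Add one point x at a time. If x adds no rank to S in \<open>r\<close>, it adds none to
  the \<open>r'\<close>-closure of S; this is a flat of \<open>r\<close>, so it contains x, and x
  adds none in \<open>r'\<close> either.\<close>

lemma rank_quotient_of_rflats:
  assumes "rank_function E r" "rank_function E r'"
    and flats: "\<And>F. rflat E r' F \<Longrightarrow> rflat E r F"
  shows "rank_quotient r r'"
proof -
  interpret r: rank_function E r by fact
  interpret r': rank_function E r' by fact
  have *: "r' (A \<union> C) + r A \<le> r (A \<union> C) + r' A" if "A \<subseteq> E" "finite C" "C \<subseteq> E" for A C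
    using that(2,3)
  proof (induction C)
    case (insert x C)
    let ?S = "A \<union> C"
    have S: "?S \<subseteq> closure E r' ?S" using r'.subset_closure[of ?S] that(1) insert.prems by auto
    have "r' (insert x ?S) + r ?S \<le> r (insert x ?S) + r' ?S"
    proof (cases "r (insert x ?S) = r ?S")
      case True
      have "r (insert x (closure E r' ?S)) = r (closure E r' ?S)"
        by (rule r.insert_eq_mono[OF S True])
      then have "x \<in> closure E r' ?S"
        using r.rflat_insertD[OF flats[OF r'.rflat_closure]] insert.prems by auto
      then show ?thesis using True by (simp add: closure_def)
    next
      case False
      then have "Suc (r ?S) \<le> r (insert x ?S)" using r.mono[OF subset_insertI, of ?S x] by simp
      then show ?thesis using r'.insert_le[of x ?S] by linarith
    qed
    moreover have "r' ?S + r A \<le> r ?S + r' A" using insert by simp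
    ultimately show ?case by simp
  qed simp
  show ?thesis
    unfolding rank_quotient_def
  proof (intro allI impI)
    fix A B :: "'a set" assume "A \<subseteq> B"
    then have "(A \<inter> E) \<union> (B \<inter> E) = B \<inter> E" by auto
    then show "r' B + r A \<le> r B + r' A"
      using *[of "A \<inter> E" "B \<inter> E"] r.fin by (simp add: r.Int_ground r'.Int_ground)
  qed
qed

section \<open>Repeated truncation along one flat\<close>

lemma (in rank_function) funpow_trunc: "(trunc F ^^ a) r A = min (r A) (r (A \<union> F) - a)"
proof (induction a arbitrary: A)
  case 0
  show ?case using mono[of A "A \<union> F"] by simp
qed (auto simp: trunc_def Un_assoc)

lemma rank_function_funpow_trunc:
  assumes "rank_function E r" "a \<le> r F"
  shows "rank_function E ((trunc F ^^ a) r) \<and> rank_quotient r ((trunc F ^^ a) r)"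
  using assms(2)
proof (induction a)
  case 0
  then show ?case using assms(1) by (simp add: rank_quotient_refl)
next
  case (Suc a)
  let ?s = "(trunc F ^^ a) r"
  have s: "rank_function E ?s" "rank_quotient r ?s" using Suc by auto
  have "1 \<le> ?s F" using Suc.prems by (simp add: rank_function.funpow_trunc[OF assms(1)])
  then show ?case
    using rank_function.rank_function_trunc[OF s(1)] rank_function.rank_quotient_trunc[OF s(1)]
      rank_quotient_trans[OF s(2)] by simp
qed

text \<open>All cyclic flats so far lie in \<open>K\<close>, above which the nullity is constantly
  \<open>s\<close>. Repeated truncation along \<open>F\<close> raises the nullity to
  \<open>s + a\<close> on sets above \<open>F\<close> and leaves it unchanged on the new flats not
  above \<open>F\<close>. So \<open>F\<close> is the only new place where the nullity jumps.\<close>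

lemma cyclic_rflat_funpow_trunc:
  assumes r''_def: "r'' = (trunc F ^^ a) r'"
    and r': "rank_function E r'" "rank_quotient r r'"
    and F: "rflat E r' F" "K \<subseteq> F" "a + r' K < r' F" and K: "K \<subseteq> E" and a: "1 \<le> a"
    and cyc: "\<And>G. cyclic_rflat E r r' G \<Longrightarrow> G \<subseteq> K"
    and null: "\<And>A. K \<subseteq> A \<Longrightarrow> r' A + s = r A"
  shows "cyclic_rflat E r r'' G \<longleftrightarrow> cyclic_rflat E r r' G \<or> G = F"
proof -
  interpret r': rank_function E r' by fact
  have "rank_function E r'' \<and> rank_quotient r' r''"
    unfolding r''_def using F(3) by (intro rank_function_funpow_trunc r') simp
  then have q: "rank_quotient r' r''" and "rank_function E r''" by auto
  interpret r'': rank_function E r'' by fact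
  have r'': "r'' A = min (r' A) (r' (A \<union> F) - a)" for A by (simp add: r''_def r'.funpow_trunc)
  have mF: "r' F \<le> r' (A \<union> F)" for A by (rule r'.mono) auto
  have FE: "F \<subseteq> E" using F(1) by (simp add: rflat_def)
  have outside: "r'' G = r' G" if "rflat E r'' G" "\<not> F \<subseteq> G" for G
  proof (rule ccontr)
    \<comment> \<open>If the rank of \<open>G\<close> has dropped, adding \<open>F\<close> does not
      raise its new rank, and a flat of \<open>r''\<close> would then contain
      \<open>F\<close>.\<close>
    assume "r'' G \<noteq> r' G"
    then have "r'' G = r' (G \<union> F) - a" by (simp add: r'' min_def split: if_splits)
    moreover have "r'' (G \<union> F) \<le> r' (G \<union> F) - a" by (simp add: r'' Un_assoc)
    ultimately have "F \<subseteq> G" using r''.rflat_unionD[OF that(1) FE] by simp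
    with that(2) show False by simp
  qed
  have below: "rflat E r'' G" "r'' G = r' G" if "rflat E r' G" "G \<subseteq> K" for G
  proof -
    have "r' G \<le> r' K" using that by (intro r'.mono)
    \<comment> \<open>The strict gap between \<open>K\<close> and \<open>F\<close> leaves room for
      one more point: the second term of the minimum exceeds \<open>r' G\<close> even after
      \<open>a\<close> truncations.\<close>
    then have lt: "Suc (r' G) \<le> r' (A \<union> F) - a" for A using mF[of A] F(3) by linarith
    show eq: "r'' G = r' G" using lt[of G] by (simp add: r'')
    show "rflat E r'' G"
      unfolding rflat_def
    proof (intro conjI ballI)
      fix x assume "x \<in> E - G"
      then have "Suc (r' G) \<le> r' (insert x G)" using that(1) by (simp add: rflat_def Suc_le_eq)
      then show "r'' G < r'' (insert x G)" unfolding eq using lt[of "insert x G"] by (simp add: r'')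
    qed (use that in \<open>simp add: rflat_def\<close>)
  qed
  have above: "r'' A + (s + a) = r A" if "F \<subseteq> A" for A
  proof -
    have "A \<union> F = A" using that by auto
    moreover have "r' F \<le> r' A" using that by (rule r'.mono)
    ultimately show ?thesis using null[of A] F(2,3) that by (simp add: r'')
  qed
  have Fflat: "rflat E r'' F"
    unfolding rflat_def
  proof (intro conjI ballI)
    fix x assume "x \<in> E - F"
    then have "r' F < r' (insert x F)" using F(1) by (simp add: rflat_def)
    moreover have "K \<subseteq> insert x F" using F(2) by auto
    ultimately have "r F < r (insert x F)" using null[OF F(2)] null[of "insert x F"] by simp
    then show "r'' F < r'' (insert x F)" using above[OF order_refl] above[OF subset_insertI, of x] by linarith
  qed (rule FE)
  have le_s: "r A \<le> r' A + s" if "A \<subseteq> E" for A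
    using rank_quotientD[OF r'(2) that] null[OF K] by linarith
  show ?thesis
  proof
    assume G: "cyclic_rflat E r r'' G"
    then have Gf: "rflat E r'' G" by (simp add: cyclic_rflat_def)
    show "cyclic_rflat E r r' G \<or> G = F"
    proof (cases "F \<subseteq> G")
      case True
      have "r F + r'' G = r G + r'' F" using above[OF True] above[OF order_refl] by linarith
      then have "\<not> F \<subset> G" using G Fflat by (auto simp: cyclic_rflat_def)
      with True show ?thesis by auto
    next
      case False
      obtain F0 where F0: "F0 \<subseteq> G" "cyclic_rflat E r r' F0" "r F0 + r' G = r G + r' F0"
        using exists_cyclic_rflat[OF r'(1) rank_quotient_rflat[OF q Gf]] by blast
      have f: "rflat E r' F0" using F0(2) by (simp add: cyclic_rflat_def)
      have "r F0 + r'' G = r G + r'' F0"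
        using F0(3) outside[OF Gf False] below(2)[OF f cyc[OF F0(2)]] by simp
      then have "\<not> F0 \<subset> G" using G below(1)[OF f cyc[OF F0(2)]] by (auto simp: cyclic_rflat_def)
      with F0 show ?thesis by auto
    qed
  next
    assume "cyclic_rflat E r r' G \<or> G = F"
    then show "cyclic_rflat E r r'' G"
    proof
      assume G: "cyclic_rflat E r r' G"
      then have f: "rflat E r' G" by (simp add: cyclic_rflat_def)
      show ?thesis
        unfolding cyclic_rflat_def
      proof (intro conjI allI impI)
        show "rflat E r'' G" by (rule below(1)[OF f cyc[OF G]])
        fix H assume H: "rflat E r'' H \<and> H \<subset> G"
        then have Hf: "rflat E r' H" "H \<subseteq> K" using rank_quotient_rflat[OF q] cyc[OF G] by auto
        have "r H + r' G \<noteq> r G + r' H" using G H Hf by (auto simp: cyclic_rflat_def)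
        then show "r H + r'' G \<noteq> r G + r'' H" using below(2)[OF f cyc[OF G]] below(2)[OF Hf] by simp
      qed
    next
      assume "G = F"
      have "r H + r'' F \<noteq> r F + r'' H" if "rflat E r'' H" "H \<subset> F" for H
      proof -
        have "r'' H = r' H" using that by (intro outside) auto
        moreover have "H \<subseteq> E" using that(1) by (simp add: rflat_def)
        ultimately have "r H \<le> r'' H + s" using le_s by simp
        then show ?thesis using above[of F] a by simp
      qed
      then show ?thesis using Fflat \<open>G = F\<close> by (simp add: cyclic_rflat_def)
    qed
  qed
qed

section \<open>Nested lists of flats and their truncations\<close>

definition prev_flat :: "('a set \<times> nat) list \<Rightarrow> nat \<Rightarrow> 'a set" where
  "prev_flat D i = (if i = 0 then {} else fst (D ! (i - 1)))"

text \<open>Index i, counted from 0, holds the pair (F_{i+1}, a_{i+1}). The empty set plays F_0, and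
  \<open>prev_flat D (length D)\<close> is the last flat, to which an extension of the list is
  compared.\<close>

definition nested_list :: "'a set \<Rightarrow> ('a set \<Rightarrow> nat) \<Rightarrow> ('a set \<times> nat) list \<Rightarrow> bool" where
  "nested_list E r D \<longleftrightarrow> (\<forall>i<length D. rflat E r (fst (D ! i)) \<and> prev_flat D i \<subset> fst (D ! i) \<and>
     1 \<le> snd (D ! i) \<and> snd (D ! i) + r (prev_flat D i) < r (fst (D ! i)))"

definition truncs :: "('a set \<Rightarrow> nat) \<Rightarrow> ('a set \<times> nat) list \<Rightarrow> 'a set \<Rightarrow> nat" where
  "truncs r D = foldl (\<lambda>r (F, a). (trunc F ^^ a) r) r D"

lemma truncs_Nil [simp]: "truncs r [] = r"
  by (simp add: truncs_def)

lemma truncs_snoc [simp]: "truncs r (D @ [(F, a)]) = (trunc F ^^ a) (truncs r D)"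
  by (simp add: truncs_def)

lemma prev_flat_append: "i \<le> length D \<Longrightarrow> prev_flat (D @ D') i = prev_flat D i"
  by (cases i) (auto simp: prev_flat_def nth_append)

lemma prev_flat_snoc_length [simp]: "prev_flat (D @ [x]) (Suc (length D)) = fst x"
  by (simp add: prev_flat_def)

lemma nested_list_snoc:
  "nested_list E r (D @ [(F, a)]) \<longleftrightarrow> nested_list E r D \<and> rflat E r F \<and>
     prev_flat D (length D) \<subset> F \<and> 1 \<le> a \<and> a + r (prev_flat D (length D)) < r F"
  unfolding nested_list_def
  by (auto simp: less_Suc_eq all_conj_distrib nth_append prev_flat_append)

lemma nested_list_last_subset:
  "nested_list E r D \<Longrightarrow> prev_flat D (length D) \<subseteq> E"
  by (cases D rule: rev_cases) (auto simp: nested_list_snoc rflat_def prev_flat_def)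

lemma nested_list_le_last:
  "nested_list E r D \<Longrightarrow> F \<in> fst ` set D \<Longrightarrow> F \<subseteq> prev_flat D (length D)"
proof (induction D rule: rev_induct)
  case (snoc x D)
  obtain G a where x: "x = (G, a)" by (cases x)
  show ?case using snoc unfolding x by (fastforce simp: nested_list_snoc prev_flat_def)
qed simp

lemma nested_list_sorted: "nested_list E r D \<Longrightarrow> sorted_wrt (\<subset>) (map fst D)"
proof (induction D rule: rev_induct)
  case (snoc x D)
  obtain G a where x: "x = (G, a)" by (cases x)
  have D: "nested_list E r D" "prev_flat D (length D) \<subset> G" using snoc.prems by (auto simp: x nested_list_snoc)
  have "F \<subset> G" if "F \<in> fst ` set D" for F using nested_list_le_last[OF D(1) that] D(2) by auto
  then show ?case using snoc.IH[OF D(1)] by (auto simp: x sorted_wrt_append)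
qed simp

lemma nested_list_nonempty: "nested_list E r D \<Longrightarrow> F \<in> fst ` set D \<Longrightarrow> F \<noteq> {}"
proof -
  assume D: "nested_list E r D" "F \<in> fst ` set D"
  then obtain i where "i < length D" "F = fst (D ! i)" by (auto simp: in_set_conv_nth)
  then have "prev_flat D i \<subset> F" using D(1) by (simp add: nested_list_def)
  then show "F \<noteq> {}" by auto
qed

text \<open>By \<open>a < r' F\<close> the flat has rank at least two before each of the
  \<open>a\<close> truncations, as \<open>iter_trunc.step\<close> requires.\<close>

lemma iter_trunc_funpow:
  assumes "iter_trunc E r r'" "rflat E r F" "a < r' F" "rank_function E r'"
  shows "iter_trunc E r ((trunc F ^^ a) r')"
  using assms(3)
proof (induction a)
  case (Suc a)
  have "2 \<le> (trunc F ^^ a) r' F" using Suc.prems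
    by (simp add: rank_function.funpow_trunc[OF assms(4)])
  moreover have "iter_trunc E r ((trunc F ^^ a) r')" using Suc by simp
  ultimately show ?case using iter_trunc.step[OF _ assms(2)] by simp
qed (simp add: assms(1))

lemma cyclic_rflat_refl:
  assumes "rank_function E r" "\<And>x. x \<in> E \<Longrightarrow> r {x} = 1"
  shows "cyclic_rflat E r r F \<longleftrightarrow> F = {}"
proof -
  have "rflat E r {}" using assms rank_function.empty[OF assms(1)] by (simp add: rflat_def)
  then show ?thesis by (auto simp: cyclic_rflat_def)
qed

text \<open>An invariant for appending one pair. Constant nullity above the last flat is what the
  next application of \<open>cyclic_rflat_funpow_trunc\<close> needs; the last two clauses let
  \<open>D\<close> be read off from the resulting rank function.\<close>

lemma (in chow_generators) nested_truncs:
  assumes "nested_list E r D"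
  shows "iter_trunc E r (truncs r D) \<and>
    (\<forall>A. prev_flat D (length D) \<subseteq> A \<longrightarrow> truncs r D A + sum_list (map snd D) = r A) \<and>
    (\<forall>F. cyclic_rflat E r (truncs r D) F \<longleftrightarrow> F = {} \<or> F \<in> fst ` set D) \<and>
    (\<forall>i<length D. truncs r D (fst (D ! i)) + sum_list (take (Suc i) (map snd D)) = r (fst (D ! i)))"
  using assms
proof (induction D rule: rev_induct)
  case Nil
  then show ?case
    by (auto simp: iter_trunc.base cyclic_rflat_refl[OF rank_function_axioms loopless])
next
  case (snoc x D)
  obtain F a where x: "x = (F, a)" by (cases x)
  define K where "K = prev_flat D (length D)"
  define r' where "r' = truncs r D"
  define s where "s = sum_list (map snd D)"
  have D: "nested_list E r D" and F: "rflat E r F" "K \<subset> F" "1 \<le> a" "a + r K < r F"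
    using snoc.prems by (auto simp: x nested_list_snoc K_def)
  have it: "iter_trunc E r r'" and null: "\<And>A. K \<subseteq> A \<Longrightarrow> r' A + s = r A"
    and cyc: "\<And>G. cyclic_rflat E r r' G \<longleftrightarrow> G = {} \<or> G \<in> fst ` set D"
    and part: "\<And>i. i < length D \<Longrightarrow> r' (fst (D ! i)) + sum_list (take (Suc i) (map snd D)) = r (fst (D ! i))"
    using snoc.IH[OF D] by (simp_all add: r'_def s_def K_def)
  note r' = iter_truncD(1,2)[OF it]
  interpret r': rank_function E r' by (rule r'(1))
  have KE: "K \<subseteq> E" using nested_list_last_subset[OF D] by (simp add: K_def)
  \<comment> \<open>\<open>K\<close> and \<open>F\<close> have the same nullity, so the gap between
    their ranks in \<open>r\<close> persists in \<open>r'\<close>.\<close>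
  have lt: "a + r' K < r' F" using null[of K] null[of F] F by auto
  have Ff: "rflat E r' F"
    unfolding rflat_def
  proof (intro conjI ballI)
    fix y assume "y \<in> E - F"
    then have "r F < r (insert y F)" using F(1) by (simp add: rflat_def)
    moreover have "K \<subseteq> F" "K \<subseteq> insert y F" using F(2) by auto
    ultimately show "r' F < r' (insert y F)" using null[of F] null[of "insert y F"] by linarith
  qed (use F(1) in \<open>simp add: rflat_def\<close>)
  have sub: "G \<subseteq> K" if "cyclic_rflat E r r' G" for G
    using that nested_list_le_last[OF D, of G] unfolding cyc K_def by auto
  have it': "iter_trunc E r ((trunc F ^^ a) r')" using lt by (intro iter_trunc_funpow it F(1) r'(1)) simp
  have cyc': "cyclic_rflat E r ((trunc F ^^ a) r') G \<longleftrightarrow> cyclic_rflat E r r' G \<or> G = F" for G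
    using F(2) by (intro cyclic_rflat_funpow_trunc[OF refl r' Ff _ lt KE F(3) sub null]) auto
  have above: "(trunc F ^^ a) r' A + (s + a) = r A" if "F \<subseteq> A" for A
  proof -
    have "A \<union> F = A" using that by auto
    moreover have "r' F \<le> r' A" using that by (rule r'.mono)
    ultimately show ?thesis using null[of A] F(2) lt that by (simp add: r'.funpow_trunc)
  qed
  have below: "(trunc F ^^ a) r' A = r' A" if "A \<subseteq> K" for A
    using r'.mono[OF that] r'.mono[of F "A \<union> F"] lt by (simp add: r'.funpow_trunc)
  have "(trunc F ^^ a) r' (fst ((D @ [x]) ! i)) + sum_list (take (Suc i) (map snd (D @ [x]))) = r (fst ((D @ [x]) ! i))"
    if "i < length (D @ [x])" for i
  proof (cases "i < length D")
    case True
    then have "fst (D ! i) \<subseteq> K" using nested_list_le_last[OF D] by (simp add: K_def)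
    then show ?thesis using True part[OF True] below by (simp add: nth_append)
  next
    case False
    then have "i = length D" using that by simp
    then show ?thesis using above[of F] by (simp add: x s_def)
  qed
  then show ?case
    using it' above cyc' cyc by (auto simp: x r'_def s_def)
qed

section \<open>Recovering a matroid from its Bergman class\<close>

lemma (in rank_function) flag_between:
  assumes "rflat E r G" "rflat E r F" "G \<subseteq> F"
  shows "\<exists>T. finite T \<and> (\<forall>H\<in>T. rflat E r H \<and> G \<subset> H \<and> H \<subseteq> F) \<and>
    (\<forall>H\<in>T. \<forall>K\<in>T. H \<subseteq> K \<or> K \<subseteq> H) \<and> card T + r G = r F \<and> (G \<noteq> F \<longrightarrow> F \<in> T)"
  using assms(1,3)
proof (induction "r F - r G" arbitrary: G rule: less_induct)
  case less
  show ?case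
  proof (cases "G = F")
    case True
    then show ?thesis by (intro exI[of _ "{}"]) simp
  next
    case False
    then obtain x where x: "x \<in> F" "x \<notin> G" using less.prems(2) by auto
    have FE: "F \<subseteq> E" using assms(2) by (simp add: rflat_def)
    define G' where "G' = closure E r (insert x G)"
    have ins: "insert x G \<subseteq> E" using x less.prems FE by auto
    have G': "rflat E r G'" "G' \<subseteq> F" "G \<subset> G'"
      using rflat_closure closure_least[OF assms(2), of "insert x G"] subset_closure[OF ins] x less.prems
      by (auto simp: G'_def)
    have "r G < r (insert x G)" using less.prems(1) x FE by (auto simp: rflat_def)
    then have rG': "r G' = Suc (r G)" using insert_le[of x G] by (simp add: G'_def rank_closure)
    moreover have "r G' \<le> r F" by (rule mono[OF G'(2)])
    ultimately have "r F - r G' < r F - r G" by linarith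
    from less.hyps[OF this G'(1,2)] obtain T where
      T: "finite T" "\<forall>H\<in>T. rflat E r H \<and> G' \<subset> H \<and> H \<subseteq> F"
        "\<forall>H\<in>T. \<forall>K\<in>T. H \<subseteq> K \<or> K \<subseteq> H" "card T + r G' = r F" "G' \<noteq> F \<longrightarrow> F \<in> T" by auto
    have "G' \<notin> T" using T(2) by auto
    moreover have "\<forall>H\<in>insert G' T. rflat E r H \<and> G \<subset> H \<and> H \<subseteq> F"
    proof
      fix H assume "H \<in> insert G' T"
      then consider "H = G'" | "H \<in> T" by blast
      then show "rflat E r H \<and> G \<subset> H \<and> H \<subseteq> F"
      proof cases
        case 2
        then have "rflat E r H" "G' \<subset> H" "H \<subseteq> F" using T(2) by simp_all
        then show ?thesis using psubset_trans[OF G'(3)] by simp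
      qed (use G' in simp)
    qed
    moreover have "\<forall>H\<in>insert G' T. \<forall>K\<in>insert G' T. H \<subseteq> K \<or> K \<subseteq> H"
      using T(2,3) by (simp add: psubset_imp_subset)
    ultimately show ?thesis using T(1,4,5) rG' by (intro exI[of _ "insert G' T"]) auto
  qed
qed

text \<open>Join a flag from {} up to \<open>F\<close> with one from \<open>F\<close> to
  \<open>E\<close> and drop \<open>E\<close>. Thus every ray occurs in a cone on which the Bergman
  class is 1.\<close>

lemma flag_through:
  assumes M: "matroid E I" and F: "F \<in> rays E I" and loop: "loopless E I"
  shows "\<exists>\<sigma>. kcone E I (rk I E - 1) \<sigma> \<and> F \<in> \<sigma>"
proof -
  interpret rank_function E "rk I" by (rule rank_function_rk[OF M])
  have F': "rflat E (rk I) F" "F \<noteq> {}" "F \<noteq> E" "F \<subseteq> E"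
    using F by (auto simp: rays_def flat_eq_rflat rflat_def)
  have e: "rflat E (rk I) {}" using loop by (simp add: loopless_iff_rk[OF M] rflat_def)
  obtain S where S: "finite S" "\<forall>H\<in>S. rflat E (rk I) H \<and> {} \<subset> H \<and> H \<subseteq> F"
      "\<forall>H\<in>S. \<forall>K\<in>S. H \<subseteq> K \<or> K \<subseteq> H" "card S + rk I {} = rk I F" "{} \<noteq> F \<longrightarrow> F \<in> S"
    using flag_between[OF e F'(1)] by auto
  obtain T where T: "finite T" "\<forall>H\<in>T. rflat E (rk I) H \<and> F \<subset> H \<and> H \<subseteq> E"
      "\<forall>H\<in>T. \<forall>K\<in>T. H \<subseteq> K \<or> K \<subseteq> H" "card T + rk I F = rk I E" "F \<noteq> E \<longrightarrow> E \<in> T"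
    using flag_between[OF F'(1) rflat_ground F'(4)] by auto
  have ST: "H \<subset> K" if "H \<in> S" "K \<in> T" for H K
    using subset_psubset_trans[of H F K] S(2) T(2) that by simp
  then have "S \<inter> T = {}" by auto
  then have "card (S \<union> T) = rk I E" using S(1,4) T(1,4) by (simp add: card_Un_disjoint)
  moreover have "E \<in> S \<union> T" using T(5) F'(3) by simp
  ultimately have "card (S \<union> T - {E}) = rk I E - 1" using S(1) T(1) by simp
  moreover have "S \<union> T - {E} \<subseteq> rays E I" using S(2) T(2) by (auto simp: rays_def flat_eq_rflat)
  moreover have "\<forall>H\<in>S \<union> T. \<forall>K\<in>S \<union> T. H \<subseteq> K \<or> K \<subseteq> H"
  proof (intro ballI)
    fix H K assume "H \<in> S \<union> T" "K \<in> S \<union> T"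
    then show "H \<subseteq> K \<or> K \<subseteq> H"
      using S(3) T(3) by (elim UnE) (simp_all add: ST psubset_imp_subset)
  qed
  ultimately have "kcone E I (rk I E - 1) (S \<union> T - {E})" using S(1) T(1) by (simp add: kcone_def)
  then show ?thesis using S(5) F'(2,3) by auto
qed

text \<open>The support of the class exhibits all proper nonempty flats, so each matroid is a
  quotient of the other; compared with {}, this bounds the ranks both ways.\<close>

lemma rank_eq_of_bergman_eq:
  assumes M: "matroid E I" "matroid E J" and L: "loopless E I" "loopless E J"
    and eq: "bergman E I = bergman E J"
  shows "rk I = rk J"
proof -
  have half: "rank_quotient (rk J) (rk I)"
    if M: "matroid E I" "matroid E J" and L: "loopless E I" "loopless E J"
      and eq: "bergman E I = bergman E J" for I J :: "'a set \<Rightarrow> bool"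
  proof (rule rank_quotient_of_rflats[OF rank_function_rk[OF M(2)] rank_function_rk[OF M(1)]])
    interpret I: rank_function E "rk I" by (rule rank_function_rk[OF M(1)])
    interpret J: rank_function E "rk J" by (rule rank_function_rk[OF M(2)])
    fix F assume F: "rflat E (rk I) F"
    consider "F = {}" | "F = E" | "F \<in> rays E I" using F by (auto simp: rays_def flat_eq_rflat)
    then show "rflat E (rk J) F"
    proof cases
      case 1
      then show ?thesis using L(2) by (simp add: loopless_iff_rk[OF M(2)] rflat_def)
    next
      case 2
      then show ?thesis by (simp add: J.rflat_ground)
    next
      case 3
      then obtain \<sigma> where \<sigma>: "kcone E I (rk I E - 1) \<sigma>" "F \<in> \<sigma>"
        using flag_through[OF M(1) _ L(1)] by blast
      have "bergman E J \<sigma> = 1" using \<sigma>(1) by (simp add: eq[symmetric] bergman_def)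
      then have "kcone E J (rk J E - 1) \<sigma>" by (simp add: bergman_def split: if_splits)
      then show ?thesis using \<sigma>(2) by (auto simp: kcone_def rays_def flat_eq_rflat)
    qed
  qed
  show ?thesis
  proof
    fix A
    have "rk I {} = 0" "rk J {} = 0"
      using rank_function_rk[OF M(1)] rank_function_rk[OF M(2)] by (simp_all add: rank_function.empty)
    then show "rk I A = rk J A"
      using rank_quotientD[OF half[OF M L eq], of "{}" A]
        rank_quotientD[OF half[OF M(2,1) L(2,1) eq[symmetric]], of "{}" A] by simp
  qed
qed

section \<open>Chains of sets as sorted lists\<close>

lemma sorted_wrt_psubset_unique:
  "sorted_wrt (\<subset>) xs \<Longrightarrow> sorted_wrt (\<subset>) ys \<Longrightarrow> set xs = set ys \<Longrightarrow> xs = (ys :: 'a set list)"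
proof (induction xs arbitrary: ys)
  case (Cons x xs)
  then obtain y ys' where ys: "ys = y # ys'" by (cases ys) auto
  have x: "\<forall>z\<in>set xs. x \<subset> z" and y: "\<forall>z\<in>set ys'. y \<subset> z" using Cons.prems by (auto simp: ys)
  have "x \<in> insert y (set ys')" "y \<in> insert x (set xs)" using Cons.prems(3) by (auto simp: ys)
  then have "x = y \<or> y \<subset> x" "y = x \<or> x \<subset> y" using x y by (simp_all add: insert_iff) blast+
  then have xy: "x = y" using less_asym[of x y] by auto
  have "set xs = set ys'"
  proof -
    have "x \<notin> set xs" "y \<notin> set ys'" using x y by auto
    moreover have "insert x (set xs) = insert y (set ys')" using Cons.prems(3) by (simp add: ys)
    ultimately show ?thesis unfolding xy by (metis insert_ident)
  qed
  then show ?case using Cons.IH[of ys'] Cons.prems by (simp add: ys xy)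
qed simp

lemma finite_chain_sorted_list:
  assumes "finite S" "\<forall>K\<in>S. \<forall>L\<in>S. K \<subseteq> L \<or> L \<subseteq> (K :: 'a set)"
  shows "\<exists>xs. set xs = S \<and> sorted_wrt (\<subset>) xs"
  using assms
proof (induction "card S" arbitrary: S)
  case 0
  then show ?case by (intro exI[of _ "[]"]) auto
next
  case (Suc n)
  then have "S \<noteq> {}" by auto
  then obtain M where M: "M \<in> S" "\<forall>K\<in>S. K \<subseteq> M" using finite_chain_greatest[OF Suc.prems(1) _ Suc.prems(2)] by blast
  have "n = card (S - {M})" using Suc M(1) by simp
  then obtain xs where xs: "set xs = S - {M}" "sorted_wrt (\<subset>) xs"
    using Suc.hyps(1)[of "S - {M}"] Suc.prems by auto
  have "set (xs @ [M]) = S" using xs(1) M(1) by auto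
  moreover have "sorted_wrt (\<subset>) (xs @ [M])" using xs M(2) by (auto simp: sorted_wrt_append)
  ultimately show ?case by blast
qed

section \<open>Nested lists correspond to relative nested quotients\<close>

context chow_generators
begin

text \<open>The nonempty cyclic flats, sorted by inclusion, give the flats of the list; successive
  differences of their nullities give the exponents.\<close>

lemma nested_truncs_inj:
  assumes D1: "nested_list E r D1" and D2: "nested_list E r D2" and eq: "truncs r D1 = truncs r D2"
  shows "D1 = D2"
proof -
  let ?t = "truncs r D1"
  have "insert {} (fst ` set D1) = insert {} (fst ` set D2)"
  proof (rule set_eqI)
    fix F show "F \<in> insert {} (fst ` set D1) \<longleftrightarrow> F \<in> insert {} (fst ` set D2)"
      using nested_truncs[OF D1] nested_truncs[OF D2] unfolding eq by simp
  qed
  moreover have "{} \<notin> fst ` set D1" "{} \<notin> fst ` set D2"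
    using nested_list_nonempty[OF D1] nested_list_nonempty[OF D2] by blast+
  ultimately have "set (map fst D1) = set (map fst D2)" by (metis insert_ident set_map)
  then have fst_eq: "map fst D1 = map fst D2"
    using nested_list_sorted[OF D1] nested_list_sorted[OF D2] by (intro sorted_wrt_psubset_unique)
  then have len: "length D1 = length D2" by (rule map_eq_imp_length_eq)
  have fst_nth: "fst (D1 ! i) = fst (D2 ! i)" if "i < length D1" for i
    using arg_cong[OF fst_eq, of "\<lambda>xs. xs ! i"] that len by simp
  have part: "sum_list (take i (map snd D1)) = sum_list (take i (map snd D2))" if "i \<le> length D1" for i
  proof (cases i)
    case (Suc j)
    then have "?t (fst (D1 ! j)) + sum_list (take i (map snd D1)) = r (fst (D1 ! j))"
      "?t (fst (D2 ! j)) + sum_list (take i (map snd D2)) = r (fst (D2 ! j))"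
      using nested_truncs[OF D1] nested_truncs[OF D2] that len eq by auto
    then show ?thesis using fst_nth[of j] that Suc by simp
  qed simp
  have "snd (D1 ! i) = snd (D2 ! i)" if "i < length D1" for i
    using part[of "Suc i"] part[of i] that len by (simp add: take_Suc_conv_app_nth)
  then show ?thesis using fst_nth len by (intro nth_equalityI prod_eqI) auto
qed

text \<open>The list is forced: sorted nonempty cyclic flats with successive nullity differences.
  Its truncation has the cyclic flats of \<open>r'\<close> with the same nullities, hence equals
  \<open>r'\<close>.\<close>

lemma nested_truncs_surj:
  assumes r': "rank_function E r'" "rank_quotient r r'" and loop: "\<And>x. x \<in> E \<Longrightarrow> r' {x} = 1"
    and nested: "\<And>F G. cyclic_rflat E r r' F \<Longrightarrow> cyclic_rflat E r r' G \<Longrightarrow> F \<subseteq> G \<or> G \<subseteq> F"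
    and c: "r' E + c = r E"
  shows "\<exists>D. nested_list E r D \<and> sum_list (map snd D) = c \<and> truncs r D = r'"
proof -
  interpret r': rank_function E r' by fact
  define n where "n F = r F - r' F" for F
  have le: "r' F \<le> r F" for F using rank_quotientD[OF r'(2), of "{}" F] by simp
  have n: "n F + r' F = r F" for F using le[of F] by (simp add: n_def)
  have n_mono: "n F \<le> n G" if "F \<subseteq> G" for F G
    using rank_quotientD[OF r'(2) that] n[of F] n[of G] by linarith
  have flat: "rflat E r' F" if "cyclic_rflat E r r' F" for F using that by (simp add: cyclic_rflat_def)
  have n_less: "n F < n G" if "cyclic_rflat E r r' F" "cyclic_rflat E r r' G" "F \<subset> G" for F G
  proof -
    have "r F + r' G \<noteq> r G + r' F" using that flat[OF that(1)] by (simp add: cyclic_rflat_def)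
    then have "n F \<noteq> n G" using n[of F] n[of G] by linarith
    then show ?thesis using n_mono[of F G] that(3) by auto
  qed
  have empty: "cyclic_rflat E r r' {}" using loop by (simp add: cyclic_rflat_def rflat_def)
  have "finite {F. cyclic_rflat E r r' F}"
    by (rule finite_subset[OF _ r'.finite_rflats]) (auto simp: cyclic_rflat_def)
  then have "\<exists>Fs. set Fs = {F. cyclic_rflat E r r' F} - {{}} \<and> sorted_wrt (\<subset>) Fs"
    using nested by (intro finite_chain_sorted_list) auto
  then obtain Fs where Fs: "set Fs = {F. cyclic_rflat E r r' F} - {{}}" "sorted_wrt (\<subset>) Fs" by blast
  define P where "P i = (if i = 0 then {} else Fs ! (i - 1))" for i
  define D where "D = map (\<lambda>i. (Fs ! i, n (Fs ! i) - n (P i))) [0..<length Fs]"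
  have len: "length D = length Fs" by (simp add: D_def)
  have nth: "fst (D ! i) = Fs ! i" "snd (D ! i) = n (Fs ! i) - n (P i)" if "i < length Fs" for i
    using that by (simp_all add: D_def)
  have prev: "prev_flat D i = P i" if "i \<le> length Fs" for i
    using that nth[of "i - 1"] by (simp add: prev_flat_def P_def)
  have cycF: "cyclic_rflat E r r' (Fs ! i)" "Fs ! i \<noteq> {}" if "i < length Fs" for i
    using nth_mem[OF that] Fs(1) by auto
  have cycP: "cyclic_rflat E r r' (P i)" if "i \<le> length Fs" for i
    using that empty cycF(1)[of "i - 1"] by (auto simp: P_def)
  have sub: "P i \<subset> Fs ! i" if "i < length Fs" for i
  proof (cases i)
    case 0
    then show ?thesis using cycF(2)[OF that] by (auto simp: P_def)
  next
    case (Suc j)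
    then show ?thesis using sorted_wrt_nth_less[OF Fs(2), of j i] that by (simp add: P_def)
  qed
  have D: "nested_list E r D"
    unfolding nested_list_def
  proof (intro allI impI)
    fix i assume "i < length D"
    then have i: "i < length Fs" by (simp add: len)
    have "n (P i) < n (Fs ! i)" using cycP[of i] cycF[OF i] sub[OF i] i by (intro n_less) auto
    \<comment> \<open>Strict growth of the nullity makes the exponent positive; strict growth of
      \<open>r'\<close> gives the upper bound, since exponent + r (P i) = n (Fs ! i) + r' (P i) < r
      (Fs ! i).\<close>
    moreover have "r' (P i) < r' (Fs ! i)"
      using r'.rflat_psubset_less[OF flat[OF cycP[of i]] _ sub[OF i]] flat[OF cycF(1)[OF i]] i
      by (simp add: rflat_def)
    ultimately show "rflat E r (fst (D ! i)) \<and> prev_flat D i \<subset> fst (D ! i) \<and> 1 \<le> snd (D ! i) \<and>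
        snd (D ! i) + r (prev_flat D i) < r (fst (D ! i))"
      using i sub[OF i] rank_quotient_rflat[OF r'(2) flat[OF cycF(1)[OF i]]] n[of "P i"] n[of "Fs ! i"]
      by (simp add: nth prev) linarith
  qed
  have part: "sum_list (take i (map snd D)) = n (P i)" if "i \<le> length Fs" for i
    using that
  proof (induction i)
    case 0
    show ?case by (simp add: P_def n_def)
  next
    case (Suc i)
    then have "n (P i) \<le> n (Fs ! i)" using sub[of i] by (intro n_mono) auto
    moreover have "P (Suc i) = Fs ! i" by (simp add: P_def)
    ultimately show ?case using Suc len nth(2)[of i] by (simp add: take_Suc_conv_app_nth)
  qed
  have setD: "fst ` set D = set Fs"
  proof -
    have "map fst D = Fs" using len nth by (intro nth_equalityI) auto
    then show ?thesis by (metis list.set_map)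
  qed
  have sum: "sum_list (map snd D) = c"
  proof -
    have "sum_list (map snd D) = n (P (length Fs))" using part[of "length Fs"] len by simp
    moreover have "n E = c" using c by (simp add: n_def)
    \<comment> \<open>The exponents add up to the nullity of the last flat. It equals that of
      \<open>E\<close>, because some cyclic flat has the nullity of \<open>E\<close> and lies below
      the last one.\<close>
    moreover obtain F where F: "cyclic_rflat E r r' F" "r F + r' E = r E + r' F"
      using exists_cyclic_rflat[OF r'(1) r'.rflat_ground] by blast
    have "F \<subseteq> P (length Fs)"
    proof (cases "F = {}")
      case False
      then have "F \<in> fst ` set D" using F(1) Fs(1) by (simp add: setD)
      then show ?thesis using nested_list_le_last[OF D] prev[of "length Fs"] len by simp
    qed simp
    then have "n F \<le> n (P (length Fs))" by (rule n_mono)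
    moreover have "n F = n E" using F(2) n[of F] n[of E] by linarith
    moreover have "n (P (length Fs)) \<le> n E"
      using flat[OF cycP[of "length Fs"]] by (intro n_mono) (simp add: rflat_def)
    ultimately show ?thesis by linarith
  qed
  have t: "iter_trunc E r (truncs r D)"
    and cyc: "\<And>F. cyclic_rflat E r (truncs r D) F \<longleftrightarrow> F = {} \<or> F \<in> set Fs"
    and null: "\<And>i. i < length D \<Longrightarrow>
      truncs r D (fst (D ! i)) + sum_list (take (Suc i) (map snd D)) = r (fst (D ! i))"
    using nested_truncs[OF D] by (simp_all add: setD)
  have cyc_eq: "cyclic_rflat E r (truncs r D) F \<longleftrightarrow> cyclic_rflat E r r' F" for F
    using empty Fs(1) by (cases "F = {}") (simp_all add: cyc)
  note it = iter_truncD(1,2)[OF t]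
  have "truncs r D = r'"
  proof (rule rank_eq_of_cyclic_rflats[OF rank_function_axioms it(1) r'(1) it(2) r'(2) cyc_eq])
    fix F assume "cyclic_rflat E r (truncs r D) F"
    then consider "F = {}" | "F \<in> set Fs" by (auto simp: cyc)
    then show "truncs r D F = r' F"
    proof cases
      case 1
      then show ?thesis by (simp add: rank_function.empty[OF it(1)])
    next
      case 2
      then obtain i where i: "i < length Fs" "F = Fs ! i" by (auto simp: in_set_conv_nth)
      then have "truncs r D F + sum_list (take (Suc i) (map snd D)) = r F"
        using null[of i] len nth(1)[OF i(1)] by simp
      moreover have "sum_list (take (Suc i) (map snd D)) = n F"
        using part[of "Suc i"] i by (simp add: P_def)
      ultimately show ?thesis using n[of F] by linarith
    qed
  qed
  with D sum show ?thesis by blast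
qed

end

subsection \<open>Cap products with nested monomials\<close>

definition nested_monomial :: "nat set \<Rightarrow> (nat set \<Rightarrow> bool) \<Rightarrow> (nat set \<times> nat) list \<Rightarrow> nat chowpoly" where
  "nested_monomial E I D = (\<Prod>i<length D. hgen E I (fst (D ! i)) ^ snd (D ! i))"

lemma nested_basis_eq:
  "nested_basis E I c =
     nested_monomial E I ` {D. nested_list E (rk I) D \<and> sum_list (map snd D) = c}" (is "_ = ?R")
proof (rule set_eqI)
  fix p
  show "p \<in> nested_basis E I c \<longleftrightarrow> p \<in> ?R"
  proof
    assume "p \<in> nested_basis E I c"
    then obtain Fs as where *: "p = (\<Prod>i<length Fs. hgen E I (Fs ! i) ^ (as ! i))" "length as = length Fs"
      "\<forall>i<length Fs. flat E I (Fs ! i)"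
      "\<forall>i<length Fs. (if i = 0 then {} else Fs ! (i - 1)) \<subset> Fs ! i"
      "\<forall>i<length Fs. 1 \<le> as ! i \<and>
          as ! i + rk I (if i = 0 then {} else Fs ! (i - 1)) < rk I (Fs ! i)" "sum_list as = c"
      unfolding nested_basis_def by blast
    let ?D = "zip Fs as"
    have "prev_flat ?D i = (if i = 0 then {} else Fs ! (i - 1))" if "i < length Fs" for i
      using that *(2) by (simp add: prev_flat_def)
    then have "nested_list E (rk I) ?D" using * by (simp add: nested_list_def flat_eq_rflat)
    moreover have "p = nested_monomial E I ?D" using *(1,2) by (simp add: nested_monomial_def)
    moreover have "sum_list (map snd ?D) = c" using *(2,6) by simp
    ultimately show "p \<in> ?R" by blast
  next
    assume "p \<in> ?R"
    then obtain D where D: "p = nested_monomial E I D" "nested_list E (rk I) D" "sum_list (map snd D) = c" by blast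
    have "prev_flat D i = (if i = 0 then {} else map fst D ! (i - 1))" if "i < length D" for i
      using that by (simp add: prev_flat_def)
    then show "p \<in> nested_basis E I c"
      unfolding nested_basis_def using D
      by (intro CollectI exI[of _ "map fst D"] exI[of _ "map snd D"])
        (simp add: nested_monomial_def nested_list_def flat_eq_rflat)
  qed
qed

lemma nested_monomial_Nil [simp]: "nested_monomial E I [] = 1"
  by (simp add: nested_monomial_def)

lemma nested_monomial_snoc:
  "nested_monomial E I (D @ [(F, a)]) = nested_monomial E I D * hgen E I F ^ a"
  by (simp add: nested_monomial_def nth_append)

locale nat_matroid_chow = matroid_chow E I X
  for E :: "nat set" and I and X +
  assumes zero_in_ground: "0 \<in> E"
begin

lemma rays_sum:
  assumes "\<And>G. P G \<Longrightarrow> G \<noteq> {}" "P E"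
  shows "(\<Sum>G | G \<in> rays E I \<and> P G. X G) = (\<Sum>G | rflat E (rk I) G \<and> P G. X G) + Xv E"
proof -
  have "{G. rflat E (rk I) G \<and> P G} = insert E {G \<in> rays E I. P G}"
    using assms rflat_ground by (auto simp: rays_iff)
  moreover have "finite {G \<in> rays E I. P G}" using finite_rays[OF fin] by simp
  moreover have "E \<notin> {G \<in> rays E I. P G}" by (simp add: rays_iff)
  moreover have "X E = - Xv E" using zero_in_ground by (intro X_ground) auto
  ultimately show ?thesis by simp
qed

text \<open>Taking \<alpha> at the point 0 gives h_E - h_a with a the atom of 0, so
  \<open>hgen\<close> is h_F up to an atom term that \<open>vol\<close> does not see.\<close>

lemma subst_hgen:
  assumes F: "rflat E (rk I) F" "F \<noteq> {}"
  shows "subst Y (hgen E I F) = Xv F - Xv (closure E (rk I) {0})"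
proof -
  have "subst Y (\<Sum>G | G \<in> rays E I \<and> Q G. Xv G) = (\<Sum>G | G \<in> rays E I \<and> Q G. X G)" for Q
    by (simp add: subst_sum Y_def)
  then have "subst Y (hgen E I F) =
      (\<Sum>G | G \<in> rays E I \<and> 0 \<in> G. X G) - (\<Sum>G | G \<in> rays E I \<and> F \<subseteq> G. X G)"
    unfolding hgen_def alpha_def subst_diff by simp
  also have "(\<Sum>G | G \<in> rays E I \<and> 0 \<in> G. X G) = - Xv (closure E (rk I) {0}) + Xv E"
    using sum_X_containing[OF zero_in_ground] by (subst rays_sum) (auto simp: zero_in_ground)
  also have "(\<Sum>G | G \<in> rays E I \<and> F \<subseteq> G. X G) = - Xv F + Xv E"
    using sum_X[OF F] F by (subst rays_sum) (auto simp: rflat_def)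
  finally show ?thesis by simp
qed

lemma vol_hgen_power:
  assumes it: "iter_trunc E (rk I) r'" and F: "rflat E (rk I) F" "F \<noteq> {}" and "a < r' F"
  shows "vol E r' (subst Y (hgen E I F) ^ a * p) = vol E ((trunc F ^^ a) r') p"
  using assms(4)
proof (induction a arbitrary: p)
  case (Suc a)
  let ?s = "(trunc F ^^ a) r'"
  let ?h = "subst Y (hgen E I F)"
  have "iter_trunc E (rk I) ?s"
    using Suc.prems by (intro iter_trunc_funpow it F iter_truncD(1)[OF it]) simp
  note s = iter_truncD(1,2)[OF this]
  have "vol E r' (?h ^ Suc a * p) = vol E r' (?h ^ a * (?h * p))" by (simp add: ac_simps)
  also have "\<dots> = vol E ?s (?h * p)" using Suc by simp
  also have "\<dots> = vol E ?s (Xv F * p)"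
    by (simp add: subst_hgen[OF F] left_diff_distrib vol_diff vol_h_closure_singleton[OF s zero_in_ground])
  also have "\<dots> = vol E (trunc F ?s) p" by (rule vol_Xv_mult[OF s(1)])
  finally show ?case by simp
qed simp

lemma vol_nested_monomial:
  assumes "nested_list E (rk I) D"
  shows "vol E (rk I) (subst Y (nested_monomial E I D) * p) = vol E (truncs (rk I) D) p"
  using assms
proof (induction D arbitrary: p rule: rev_induct)
  case (snoc x D)
  obtain F a where x: "x = (F, a)" by (cases x)
  define K where "K = prev_flat D (length D)"
  have D: "nested_list E (rk I) D" and F: "rflat E (rk I) F" "K \<subset> F" "a + rk I K < rk I F"
    using snoc.prems by (auto simp: x nested_list_snoc K_def)
  note t = nested_truncs[OF D]
  have "truncs (rk I) D A + sum_list (map snd D) = rk I A" if "K \<subseteq> A" for A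
    using t that by (simp add: K_def)
  \<comment> \<open>Earlier truncations lower \<open>K\<close> and \<open>F\<close> by the same
    amount, so the gap \<open>a + rk I K < rk I F\<close> still leaves more than \<open>a\<close> at
    \<open>F\<close>.\<close>
  from this[of K] this[of F] have "a < truncs (rk I) D F" using F by auto
  moreover have "F \<noteq> {}" using F(2) by auto
  moreover have "vol E (rk I) (subst Y (nested_monomial E I (D @ [x])) * p) =
      vol E (rk I) (subst Y (nested_monomial E I D) * (subst Y (hgen E I F) ^ a * p))"
    by (simp add: x nested_monomial_snoc subst_mult subst_power mult.assoc)
  ultimately show ?case
    using t F(1) snoc.IH[OF D] by (simp add: x vol_hgen_power)
qed simp

text \<open>The monomial is absorbed into the rank function by \<open>vol_nested_monomial\<close>;
  the remaining chain monomial of the cone is evaluated by \<open>vol_chain\<close>.\<close>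

lemma cap_nested_monomial:
  assumes d: "rk I E = Suc d" and D: "nested_list E (rk I) D" and c: "sum_list (map snd D) = c"
  shows "cap E I d (d - c) (nested_monomial E I D) (bergman E I) =
    bergman E (indep_of_rank E (truncs (rk I) D))"
proof
  fix \<sigma>
  let ?t = "truncs (rk I) D"
  let ?J = "indep_of_rank E ?t"
  note t = nested_truncs[OF D]
  have it: "iter_trunc E (rk I) ?t" using t by simp
  interpret t: rank_function E ?t by (rule iter_truncD(1)[OF it])
  have tE: "?t E + c = Suc d"
    using t nested_list_last_subset[OF D] by (simp add: c d)
  \<comment> \<open>Rank at least one makes \<open>d - c\<close> a true difference, so the cones of
    the truncation have the dimension of the cap product.\<close>
  moreover have "1 \<le> ?t E"
    using t.mono[of "{0}" E] iter_truncD(3)[OF it zero_in_ground] zero_in_ground by simp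
  ultimately have tE': "?t E = Suc (d - c)" by linarith
  have raysJ: "F \<in> rays E ?J \<longleftrightarrow> rflat E ?t F \<and> F \<noteq> {} \<and> F \<noteq> E" for F
    by (simp add: rays_def flat_eq_rflat t.rk_indep_of_rank)
  have bJ: "bergman E ?J \<sigma> = (if kcone E ?J (d - c) \<sigma> then 1 else 0)"
    by (simp add: bergman_def t.rk_indep_of_rank tE')
  have rays_sub: "rays E ?J \<subseteq> rays E I"
    using rank_quotient_rflat[OF iter_truncD(2)[OF it]] by (auto simp: raysJ rays_iff)
  show "cap E I d (d - c) (nested_monomial E I D) (bergman E I) \<sigma> = bergman E ?J \<sigma>"
  proof (cases "kcone E I (d - c) \<sigma>")
    case False
    then have "\<not> kcone E ?J (d - c) \<sigma>" using rays_sub by (auto simp: kcone_def)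
    then show ?thesis using False by (simp add: cap_def bJ)
  next
    case True
    then have \<sigma>: "\<sigma> \<subseteq> rays E I" "\<forall>F\<in>\<sigma>. \<forall>G\<in>\<sigma>. F \<subseteq> G \<or> G \<subseteq> F" "finite \<sigma>" "card \<sigma> = d - c"
      by (auto simp: kcone_def)
    have "cap E I d (d - c) (nested_monomial E I D) (bergman E I) \<sigma> =
        vol E (rk I) (subst Y (nested_monomial E I D) * (\<Prod>F\<in>\<sigma>. Y F))"
      using True by (simp add: cap_def deg_fun_bergman[OF d] subst_mult)
    also have "\<dots> = vol E ?t (\<Prod>F\<in>\<sigma>. Y F)" by (rule vol_nested_monomial[OF D])
    also have "(\<Prod>F\<in>\<sigma>. Y F) = (\<Prod>F\<in>\<sigma>. X F)"
      using \<sigma>(1) by (intro prod.cong) (auto simp: Y_def)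
    also have "vol E ?t \<dots> = (if \<forall>F\<in>\<sigma>. rflat E ?t F then 1 else 0)"
    proof (rule vol_chain[OF it \<sigma>(3)])
      show "rflat E (rk I) F \<and> F \<noteq> {} \<and> F \<noteq> E" if "F \<in> \<sigma>" for F
        using subsetD[OF \<sigma>(1) that] by (simp add: rays_iff)
      show "F \<subseteq> G \<or> G \<subseteq> F" if "F \<in> \<sigma>" "G \<in> \<sigma>" for F G using \<sigma>(2) that by simp
    qed (simp add: \<sigma>(4) tE')
    also have "(\<forall>F\<in>\<sigma>. rflat E ?t F) \<longleftrightarrow> kcone E ?J (d - c) \<sigma>"
      using \<sigma> by (auto simp: kcone_def raysJ rays_iff)
    finally show ?thesis by (simp add: bJ)
  qed
qed

lemma truncs_matroid:
  assumes D: "nested_list E (rk I) D"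
  shows "matroid E (indep_of_rank E (truncs (rk I) D))"
    "loopless E (indep_of_rank E (truncs (rk I) D))"
    "is_quotient E (indep_of_rank E (truncs (rk I) D)) I"
    "relative_nested E (indep_of_rank E (truncs (rk I) D)) I"
    "rk (indep_of_rank E (truncs (rk I) D)) E + sum_list (map snd D) = rk I E"
    "rk (indep_of_rank E (truncs (rk I) D)) = truncs (rk I) D"
proof -
  let ?t = "truncs (rk I) D"
  note t = nested_truncs[OF D]
  have it: "iter_trunc E (rk I) ?t" using t by simp
  interpret t: rank_function E ?t by (rule iter_truncD(1)[OF it])
  show m: "matroid E (indep_of_rank E ?t)" by (rule t.matroid_indep_of_rank)
  show rk: "rk (indep_of_rank E ?t) = ?t" by (rule t.rk_indep_of_rank)
  show "loopless E (indep_of_rank E ?t)"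
    unfolding loopless_iff_rk[OF m] rk using iter_truncD(3)[OF it] by simp
  show "is_quotient E (indep_of_rank E ?t) I"
    using rank_quotient_rflat[OF iter_truncD(2)[OF it]] by (simp add: is_quotient_def flat_eq_rflat rk)
  show "rk (indep_of_rank E ?t) E + sum_list (map snd D) = rk I E"
    using t nested_list_last_subset[OF D] by (simp add: rk)
  have chain: "F \<subseteq> G \<or> G \<subseteq> F" if "F \<in> fst ` set D" "G \<in> fst ` set D" for F G
  proof -
    obtain i j where ij: "i < length D" "F = map fst D ! i" "j < length D" "G = map fst D ! j"
      using \<open>F \<in> _\<close> \<open>G \<in> _\<close> by (auto simp: in_set_conv_nth)
    show ?thesis
      using sorted_wrt_nth_less[OF nested_list_sorted[OF D], of i j]
        sorted_wrt_nth_less[OF nested_list_sorted[OF D], of j i] ij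
      by (cases i j rule: linorder_cases) auto
  qed
  have "cyclic_rflat E (rk I) ?t F \<longleftrightarrow> F = {} \<or> F \<in> fst ` set D" for F using t by simp
  then show "relative_nested E (indep_of_rank E ?t) I"
    unfolding relative_nested_def f_cyclic_flat_eq rk by (simp add: chain) (use chain in blast)
qed

lemma bij_betw_cap:
  assumes d: "rk I E = Suc d"
  shows "bij_betw (\<lambda>\<xi>. cap E I d (d - c) \<xi> (bergman E I)) (nested_basis E I c)
    {bergman E I' | I'. matroid E I' \<and> loopless E I' \<and> is_quotient E I' I \<and> relative_nested E I' I
      \<and> rk I' E + c = rk I E}"
proof (rule bij_betw_imageI)
  show "inj_on (\<lambda>\<xi>. cap E I d (d - c) \<xi> (bergman E I)) (nested_basis E I c)"
  proof (rule inj_onI)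
    fix p q
    assume "p \<in> nested_basis E I c" "q \<in> nested_basis E I c"
      and eq: "cap E I d (d - c) p (bergman E I) = cap E I d (d - c) q (bergman E I)"
    then obtain D1 D2 where
      D1: "p = nested_monomial E I D1" "nested_list E (rk I) D1" "sum_list (map snd D1) = c" and
      D2: "q = nested_monomial E I D2" "nested_list E (rk I) D2" "sum_list (map snd D2) = c"
      unfolding nested_basis_eq by blast
    note m1 = truncs_matroid[OF D1(2)] and m2 = truncs_matroid[OF D2(2)]
    \<comment> \<open>The cap product is a Bergman class, which determines the rank function, which
      in turn determines the list and thereby the monomial.\<close>
    have "bergman E (indep_of_rank E (truncs (rk I) D1)) = bergman E (indep_of_rank E (truncs (rk I) D2))"
      using eq unfolding D1(1) D2(1) cap_nested_monomial[OF d D1(2,3)] cap_nested_monomial[OF d D2(2,3)] .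
    then have "truncs (rk I) D1 = truncs (rk I) D2"
      using rank_eq_of_bergman_eq[OF m1(1) m2(1) m1(2) m2(2)] m1(6) m2(6) by simp
    then show "p = q" using nested_truncs_inj[OF D1(2) D2(2)] D1(1) D2(1) by simp
  qed
  show "(\<lambda>\<xi>. cap E I d (d - c) \<xi> (bergman E I)) ` nested_basis E I c =
    {bergman E I' | I'. matroid E I' \<and> loopless E I' \<and> is_quotient E I' I \<and> relative_nested E I' I
      \<and> rk I' E + c = rk I E}" (is "?L = ?R")
  proof
    show "?L \<subseteq> ?R"
    proof
      fix \<Delta> assume "\<Delta> \<in> ?L"
      then obtain D where D: "nested_list E (rk I) D" "sum_list (map snd D) = c"
        "\<Delta> = cap E I d (d - c) (nested_monomial E I D) (bergman E I)"
        unfolding nested_basis_eq by blast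
      then show "\<Delta> \<in> ?R"
        using truncs_matroid[OF D(1)] unfolding D(3) cap_nested_monomial[OF d D(1,2)] D(2) by blast
    qed
    show "?R \<subseteq> ?L"
    proof
      fix \<Delta> assume "\<Delta> \<in> ?R"
      then obtain I' where I': "\<Delta> = bergman E I'" "matroid E I'" "loopless E I'" "is_quotient E I' I"
        "relative_nested E I' I" "rk I' E + c = rk I E" by blast
      have rf: "rank_function E (rk I')" by (rule rank_function_rk[OF I'(2)])
      have rq: "rank_quotient (rk I) (rk I')"
        using I'(4) by (intro rank_quotient_of_rflats[OF rank_function_axioms rf])
          (simp add: is_quotient_def flat_eq_rflat)
      have "\<exists>D. nested_list E (rk I) D \<and> sum_list (map snd D) = c \<and> truncs (rk I) D = rk I'"
      proof (rule nested_truncs_surj[OF rf rq _ _ I'(6)])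
        show "rk I' {x} = 1" if "x \<in> E" for x using I'(3) that by (simp add: loopless_iff_rk[OF I'(2)])
        show "F \<subseteq> G \<or> G \<subseteq> F" if "cyclic_rflat E (rk I) (rk I') F" "cyclic_rflat E (rk I) (rk I') G" for F G
          using I'(5) that by (simp add: relative_nested_def f_cyclic_flat_eq)
      qed
      then obtain D where D: "nested_list E (rk I) D" "sum_list (map snd D) = c" "truncs (rk I) D = rk I'"
        by blast
      have "\<Delta> = cap E I d (d - c) (nested_monomial E I D) (bergman E I)"
        unfolding cap_nested_monomial[OF d D(1,2)] D(3) I'(1)
        using indep_eq_indep_of_rank[OF I'(2)] by simp
      then show "\<Delta> \<in> ?L" unfolding nested_basis_eq using D by blast
    qed
  qed
qed

end

theorem theorem3p24:
  fixes n d c :: nat and I :: "nat set \<Rightarrow> bool"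
  assumes "matroid {0..n} I" and "loopless {0..n} I" and "rk I {0..n} = d + 1" and "c \<le> d"
  shows "bij_betw (\<lambda>\<xi>. cap {0..n} I d (d - c) \<xi> (bergman {0..n} I))
           (nested_basis {0..n} I c)
           {bergman {0..n} I' | I'. matroid {0..n} I' \<and> loopless {0..n} I'
              \<and> is_quotient {0..n} I' I \<and> relative_nested {0..n} I' I
              \<and> rk I' {0..n} + c = rk I {0..n}}"
proof -
  interpret r: rank_function "{0..n}" "rk I" by (rule rank_function_rk[OF assms(1)])
  obtain X :: "nat set \<Rightarrow> nat chowpoly" where X: "\<And>F. homogeneous 1 (X F)"
    "\<And>F. rflat {0..n} (rk I) F \<Longrightarrow> (\<Sum>G | rflat {0..n} (rk I) G \<and> F \<subseteq> G. X G) = - Xv F"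
    using r.chow_generators_exist by blast
  interpret nat_matroid_chow "{0..n}" I X
  proof unfold_locales
    show "rk I {x} = 1" if "x \<in> {0..n}" for x using assms(1,2) that by (simp add: loopless_iff_rk)
  qed (use X assms(1) in simp_all)
  show ?thesis using assms(3) by (intro bij_betw_cap) simp
qed

end
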